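(* Let $\mu=\frac{3\sqrt2}{8}e^{i\pi/8}$ and let $T:S^1\to S^1$ be the Blaschke product $$T(z)=\frac{z(\mu-z)}{1-\bar\mu z}.$$ Let $F_0,F_1,F_2,F_3\subset\mathbb{C}$ be the open disks with the following centers and radii: - $F_0$: center $0$, radius $0.51$; - $F_1$: center $1$, radius $0.1$; - $F_2$: center $0.4899611118286257-0.20294853755482672\,i$, radius $0.01$; - $F_3$: center $0.4899611118286279+0.20294853755482584\,i$, radius $0.01$. Then (a) $\sigma(\mathcal{L}_T)\subset\bigcup_{j=0}^3F_j$; and (b) $\mathfrak{m}_{F_j}(\mathcal{L}_T)=1$ for $j=1,2,3$.
   Context: $S^1$ is the unit circle in $\mathbb{C}$. For $r>1$, $\mathfrak{U}_r=\{z\in\mathbb{C}: r^{-1}<|z|<r\}$. For complex-valued $f\in L^1(S^1)$ and $k\in\mathbb{Z}$, $c_k(f)=\frac{1}{2\pi i}\int_{S^1}\frac{f(z)}{z^{k+1}}\,dz$. For $\eta\ge0$, $\mathcal{A}_\eta$ is the Banach space of $f\in L^1(S^1)$ for which $\|f\|_{\mathcal{A}_\eta}=\sum_{k\in\mathbb{Z}}e^{2\pi|k|\eta}|c_k(f)|$ is finite. The transfer operator of $T$ is $\mathcal{L}_T\varphi(x)=\sum_{y\in T^{-1}x}\frac{\varphi(y)}{|T'(y)|}$. The map $T$ is analytic and uniformly expanding ($|T'|>1$ on $S^1$). Fix $0<\eta<\rho$ such that, for some $\epsilon>0$, $T$ extends analytically to $\mathfrak{U}_{e^{2\pi\eta}+\epsilon}$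 and $\mathfrak{U}_{e^{2\pi\rho}}\cap T(\partial\mathfrak{U}_{e^{2\pi\eta}})=\emptyset$; such $\eta,\rho$ exist. Then $\mathcal{L}_T$ is a compact operator on $\mathcal{A}_\alpha$ for every $\alpha\in[\eta,\rho)$, with spectrum independent of $\alpha$ in that range, denoted $\sigma(\mathcal{L}_T)$. $\mathfrak{m}_S(\mathcal{L}_T)$ is the sum of the algebraic multiplicities of the eigenvalues of $\mathcal{L}_T$ (on $\mathcal{A}_\alpha$) in $S$. *)

theory Defs
  imports "HOL-Complex_Analysis.Complex_Analysis"
begin

section \<open>The space of integrable functions on the unit circle, modulo null sets\<close>

text \<open>
  A function on the circle is given by a function on \<open>\<complex>\<close>, of which only the values on
  \<open>sphere 0 1\<close> matter; \<open>circlepath 0 1 t\<close> is \<open>exp (2 \<pi> \<i> t)\<close>.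
\<close>

definition integrable_circle :: "(complex \<Rightarrow> complex) \<Rightarrow> bool" where
  "integrable_circle f \<longleftrightarrow> (\<lambda>t. f (circlepath 0 1 t)) absolutely_integrable_on {0..1}"

definition L1_rel :: "(complex \<Rightarrow> complex) \<Rightarrow> (complex \<Rightarrow> complex) \<Rightarrow> bool" where
  "L1_rel f g \<longleftrightarrow> integrable_circle f \<and> integrable_circle g \<and>
     negligible {t \<in> {0..1}. f (circlepath 0 1 t) \<noteq> g (circlepath 0 1 t)}"

lemma L1_relI_comp:
  assumes "L1_rel f f'" "L1_rel g g'"
    and "integrable_circle (\<lambda>z. h (f z) (g z))" "integrable_circle (\<lambda>z. h (f' z) (g' z))"
  shows "L1_rel (\<lambda>z. h (f z) (g z)) (\<lambda>z. h (f' z) (g' z))"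
  unfolding L1_rel_def
proof (intro conjI assms(3,4))
  let ?c = "circlepath 0 1"
  have "negligible ({t \<in> {0..1}. f (?c t) \<noteq> f' (?c t)} \<union> {t \<in> {0..1}. g (?c t) \<noteq> g' (?c t)})"
    using assms(1,2) by (auto simp: L1_rel_def)
  then show "negligible {t \<in> {0..1}. h (f (?c t)) (g (?c t)) \<noteq> h (f' (?c t)) (g' (?c t))}"
    by (rule negligible_subset) auto
qed

lemma part_equivp_L1_rel: "part_equivp L1_rel"
proof (rule part_equivpI)
  show "\<exists>f. L1_rel f f"
    by (rule exI[of _ "\<lambda>_. 0"]) (simp add: L1_rel_def integrable_circle_def)
  show "symp L1_rel"
    by (rule sympI) (auto simp: L1_rel_def eq_commute)
  show "transp L1_rel"
  proof (rule transpI)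
    fix f g h assume fg: "L1_rel f g" and gh: "L1_rel g h"
    let ?c = "circlepath 0 1"
    have "negligible ({t \<in> {0..1}. f (?c t) \<noteq> g (?c t)} \<union> {t \<in> {0..1}. g (?c t) \<noteq> h (?c t)})"
      using fg gh by (auto simp: L1_rel_def)
    then have "negligible {t \<in> {0..1}. f (?c t) \<noteq> h (?c t)}"
      by (rule negligible_subset) auto
    then show "L1_rel f h" using fg gh by (auto simp: L1_rel_def)
  qed
qed

quotient_type L1_circle = "complex \<Rightarrow> complex" / partial: L1_rel
  morphisms rep_L1 abs_L1
  by (rule part_equivp_L1_rel)

lemma integrable_circle_intros:
  "integrable_circle (\<lambda>_. 0)"
  "integrable_circle f \<Longrightarrow> integrable_circle g \<Longrightarrow> integrable_circle (\<lambda>z. f z + g z)"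
  "integrable_circle f \<Longrightarrow> integrable_circle g \<Longrightarrow> integrable_circle (\<lambda>z. f z - g z)"
  "integrable_circle f \<Longrightarrow> integrable_circle (\<lambda>z. - f z)"
  "integrable_circle f \<Longrightarrow> integrable_circle (\<lambda>z. a * f z)"
  by (simp_all add: integrable_circle_def set_integrable_def
        scaleR_conv_of_real mult.left_commute[of _ a] integrable_mult_right
        distrib_left right_diff_distrib)

lemma L1_rel_integrable: "L1_rel f g \<Longrightarrow> integrable_circle f" "L1_rel f g \<Longrightarrow> integrable_circle g"
  by (simp_all add: L1_rel_def)

instantiation L1_circle :: ab_group_add
begin

lift_definition zero_L1_circle :: L1_circle is "\<lambda>_. 0"
  by (simp add: L1_rel_def integrable_circle_intros)

lift_definition plus_L1_circle :: "L1_circle \<Rightarrow> L1_circle \<Rightarrow> L1_circle" is "\<lambda>f g z. f z + g z"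
  by (rule L1_relI_comp) (auto intro: integrable_circle_intros L1_rel_integrable)

lift_definition minus_L1_circle :: "L1_circle \<Rightarrow> L1_circle \<Rightarrow> L1_circle" is "\<lambda>f g z. f z - g z"
  by (rule L1_relI_comp) (auto intro: integrable_circle_intros L1_rel_integrable)

lift_definition uminus_L1_circle :: "L1_circle \<Rightarrow> L1_circle" is "\<lambda>f z. - f z"
  by (rule L1_relI_comp[where h = "\<lambda>x _. - x"])
     (auto intro: integrable_circle_intros L1_rel_integrable)

instance
  by standard (transfer; simp add: L1_rel_def algebra_simps integrable_circle_intros)+

end

lift_definition scale_L1 :: "complex \<Rightarrow> L1_circle \<Rightarrow> L1_circle" is "\<lambda>a f z. a * f z"
  by (rule L1_relI_comp[where h = "\<lambda>x _. _ * x"])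
     (auto intro: integrable_circle_intros L1_rel_integrable)

global_interpretation L1: vector_space scale_L1
  by standard (transfer; simp add: L1_rel_def algebra_simps integrable_circle_intros)+


section \<open>Fourier coefficients and the spaces \<open>\<A>\<^sub>\<eta>\<close>\<close>

lift_definition fourier_coeff :: "L1_circle \<Rightarrow> int \<Rightarrow> complex" is
  "\<lambda>f k. 1 / (2 * of_real pi * \<i>) * contour_integral (circlepath 0 1) (\<lambda>z. f z / z powi (k + 1))"
proof (rule ext)
  fix f g :: "complex \<Rightarrow> complex" and k :: int
  assume "L1_rel f g"
  then have "negligible {t \<in> {0..1}. f (circlepath 0 1 t) \<noteq> g (circlepath 0 1 t)}"
    by (simp add: L1_rel_def)
  then have "contour_integral (circlepath 0 1) (\<lambda>z. f z / z powi (k + 1)) =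
      contour_integral (circlepath 0 1) (\<lambda>z. g z / z powi (k + 1))"
    unfolding contour_integral_integral by (rule integral_spike) auto
  then show "1 / (2 * of_real pi * \<i>) *
        contour_integral (circlepath 0 1) (\<lambda>z. f z / z powi (k + 1)) =
      1 / (2 * of_real pi * \<i>) *
        contour_integral (circlepath 0 1) (\<lambda>z. g z / z powi (k + 1))"
    by simp
qed

definition A_space :: "real \<Rightarrow> L1_circle set" where
  "A_space \<eta> = {f. (\<lambda>k. exp (2 * pi * real_of_int \<bar>k\<bar> * \<eta>) * cmod (fourier_coeff f k))
                 summable_on UNIV}"

definition A_norm :: "real \<Rightarrow> L1_circle \<Rightarrow> real" where
  "A_norm \<eta> f = (\<Sum>\<^sub>\<infinity>k. exp (2 * pi * real_of_int \<bar>k\<bar> * \<eta>) * cmod (fourier_coeff f k))"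


section \<open>Transfer operator\<close>

definition transfer_fun ::
    "(complex \<Rightarrow> complex) \<Rightarrow> (complex \<Rightarrow> complex) \<Rightarrow> complex \<Rightarrow> complex" where
  "transfer_fun T \<phi> x = (\<Sum>y\<in>{y \<in> sphere 0 1. T y = x}. \<phi> y / of_real (cmod (deriv T y)))"

text \<open>
  For an analytic expanding circle map \<open>T\<close>, the map \<open>transfer_fun T\<close> preserves integrability and
  almost-everywhere equality, so the choice of representative below does not matter.
\<close>

definition transfer_op :: "(complex \<Rightarrow> complex) \<Rightarrow> L1_circle \<Rightarrow> L1_circle" where
  "transfer_op T \<phi> = abs_L1 (transfer_fun T (rep_L1 \<phi>))"


section \<open>Spectrum and algebraic multiplicities of an operator on \<open>\<A>\<^sub>\<alpha>\<close>\<close>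

text \<open>
  The operator \<open>L\<close> is meant to be linear and bounded from \<open>A_space \<alpha>\<close> to itself. The second
  conjunct says that the inverse of \<open>\<zeta> - L\<close> is bounded.
\<close>

definition resolvent_set :: "real \<Rightarrow> (L1_circle \<Rightarrow> L1_circle) \<Rightarrow> complex set" where
  "resolvent_set \<alpha> L = {\<zeta>.
     bij_betw (\<lambda>f. scale_L1 \<zeta> f - L f) (A_space \<alpha>) (A_space \<alpha>) \<and>
     (\<exists>C. \<forall>f\<in>A_space \<alpha>. A_norm \<alpha> f \<le> C * A_norm \<alpha> (scale_L1 \<zeta> f - L f))}"

definition spectrum :: "real \<Rightarrow> (L1_circle \<Rightarrow> L1_circle) \<Rightarrow> complex set" where
  "spectrum \<alpha> L = - resolvent_set \<alpha> L"

definition eigenvalues :: "real \<Rightarrow> (L1_circle \<Rightarrow> L1_circle) \<Rightarrow> complex set" where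
  "eigenvalues \<alpha> L = {\<zeta>. \<exists>f\<in>A_space \<alpha>. f \<noteq> 0 \<and> L f = scale_L1 \<zeta> f}"

definition generalized_eigenspace ::
    "real \<Rightarrow> (L1_circle \<Rightarrow> L1_circle) \<Rightarrow> complex \<Rightarrow> L1_circle set" where
  "generalized_eigenspace \<alpha> L \<zeta> =
     {f \<in> A_space \<alpha>. \<exists>n. ((\<lambda>g. scale_L1 \<zeta> g - L g) ^^ n) f = 0}"

definition alg_multiplicity :: "real \<Rightarrow> (L1_circle \<Rightarrow> L1_circle) \<Rightarrow> complex \<Rightarrow> enat" where
  "alg_multiplicity \<alpha> L \<zeta> =
     (let V = generalized_eigenspace \<alpha> L \<zeta>
      in if \<exists>B. finite B \<and> V \<subseteq> L1.span B then enat (L1.dim V) else \<infinity>)"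

definition total_multiplicity :: "real \<Rightarrow> (L1_circle \<Rightarrow> L1_circle) \<Rightarrow> complex set \<Rightarrow> enat" where
  "total_multiplicity \<alpha> L S = (\<Sum>\<^sub>\<infinity>\<zeta>\<in>S \<inter> eigenvalues \<alpha> L. alg_multiplicity \<alpha> L \<zeta>)"


section \<open>The standing assumption on \<open>\<eta>\<close> and \<open>\<rho>\<close>\<close>

definition annulus :: "real \<Rightarrow> complex set" where
  "annulus r = {z. inverse r < cmod z \<and> cmod z < r}"

text \<open>The function \<open>g\<close> is the analytic extension of the circle map \<open>T\<close>.\<close>

definition admissible :: "(complex \<Rightarrow> complex) \<Rightarrow> real \<Rightarrow> real \<Rightarrow> bool" where
  "admissible T \<eta> \<rho> \<longleftrightarrow> 0 < \<eta> \<and> \<eta> < \<rho> \<and>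
     (\<exists>\<epsilon>>0. \<exists>g. g holomorphic_on annulus (exp (2 * pi * \<eta>) + \<epsilon>) \<and>
        (\<forall>z\<in>sphere 0 1. g z = T z) \<and>
        annulus (exp (2 * pi * \<rho>)) \<inter> g ` frontier (annulus (exp (2 * pi * \<eta>))) = {})"


section \<open>The Blaschke product and the disks\<close>

definition \<mu> :: complex where
  "\<mu> = of_real (3 * sqrt 2 / 8) * exp (\<i> * of_real pi / 8)"

definition blaschke :: "complex \<Rightarrow> complex" where
  "blaschke z = z * (\<mu> - z) / (1 - cnj \<mu> * z)"

definition F :: "nat \<Rightarrow> complex set" where
  "F j = [ball 0 0.51,
          ball 1 0.1,
          ball (Complex 0.4899611118286257 (- 0.20294853755482672)) 0.01,
          ball (Complex 0.4899611118286279 0.20294853755482584) 0.01] ! j"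

end

theory Submission
  imports Defs
begin

text \<open>
  Write \<open>T\<close> for the Blaschke product and \<open>L\<close> for its transfer operator. The map \<open>T\<close> extends to the
  unit disk, fixes \<open>0\<close> and has the form \<open>T z = z * B z\<close> with \<open>B\<close> holomorphic and \<open>B 0 = \<mu>\<close>.
  A change of variables gives \<open>c\<^sub>k (L f) = \<integral> f * T\<^bsup>-k\<^esup>\<close> over the circle with normalised arc length, so on
  Fourier coefficients \<open>L\<close> acts by the matrix \<open>M k j = \<integral> z\<^sup>j * T\<^bsup>-k\<^esup>\<close>. For \<open>k = - m\<close> with \<open>m \<ge> 0\<close>
  the function \<open>T\<^sup>m = z\<^sup>m * B\<^sup>m\<close> vanishes to order \<open>m\<close> at \<open>0\<close>, and the mean value property leaves only
  entries with \<open>j \<le> k\<close>, the diagonal one being \<open>\<mu>\<^sup>m\<close>. Rows with \<open>k > 0\<close> are the complex conjugates of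
  those with \<open>k < 0\<close>, since \<open>T\<close> has modulus \<open>1\<close> on the circle. So \<open>M\<close> is triangular when the indices
  are ordered by \<open>\<bar>k\<bar>\<close>, and its diagonal consists of \<open>1\<close> and the powers of \<open>\<mu>\<close> and of its conjugate.
  Because \<open>\<bar>\<mu>\<bar>\<^sup>2 = 9/32 < 0.51\<close>, the only diagonal entries outside \<open>F 0\<close> are \<open>1\<close>, \<open>\<mu>\<close> and the
  conjugate of \<open>\<mu>\<close>, which lie in \<open>F 1\<close>, \<open>F 3\<close> and \<open>F 2\<close> and occur once each.

  That the spectrum of an infinite triangular matrix is contained in its diagonal together with \<open>0\<close>
  needs decay of the entries, and this is what the condition on \<open>\<eta>\<close> and \<open>\<rho>\<close> provides: \<open>T\<close>
  maps the circle of radius \<open>exp (- 2 * pi * \<eta>)\<close> into the disk of radius \<open>exp (- 2 * pi * \<rho>)\<close>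
  (\<open>admissible_contraction\<close>), so Cauchy's inequality on the smaller circle bounds \<open>M k j\<close>. With the
  weights \<open>w k\<close> of the norm this becomes \<open>w k * \<bar>M k j\<bar> \<le> a k * w j\<close> with a summable sequence \<open>a\<close>.
  Under this bound, rescaling finitely many weights makes the part of \<open>M\<close> off the diagonal as
  small as desired (\<open>damping_weights\<close>), which yields a bounded inverse of \<open>\<zeta> - M\<close> on finitely
  supported vectors and then everywhere (\<open>resolvent_estimate\<close>, \<open>surjective\<close>). For a diagonal entry that
  occurs once and whose column vanishes off the diagonal, the same argument applied after deleting its
  row shows that the generalized eigenspace is a line (\<open>simple_eigenvalue\<close>).

  Two facts connect functions with coefficients: an integrable function on the circle is determined
  by its Fourier coefficients (\<open>fourier_coeff_inject\<close>), and every absolutely summable sequence is a sequence of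
  Fourier coefficients (\<open>fourier_coeff_fourier_sum\<close>). Hence \<open>A_space \<alpha>\<close> is a weighted \<open>\<ell>\<^sup>1\<close> space on
  which \<open>L\<close> is the matrix \<open>M\<close>.
\<close>

section \<open>Triangular matrices on weighted sequence spaces\<close>

lemma summable_on_product:
  fixes f :: "'a \<Rightarrow> real" and g :: "'b \<Rightarrow> real"
  assumes "f summable_on UNIV" "g summable_on UNIV" "\<And>x. 0 \<le> f x" "\<And>y. 0 \<le> g y"
  shows "(\<lambda>(x, y). f x * g y) summable_on UNIV \<times> UNIV"
proof (rule summable_on_SigmaI[where g = "\<lambda>x. f x * infsum g UNIV"])
  show "((\<lambda>y. case (x, y) of (x, y) \<Rightarrow> f x * g y) has_sum f x * infsum g UNIV) UNIV" for x
    using assms(2) by (auto intro!: has_sum_cmult_right)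
  show "(\<lambda>x. f x * infsum g UNIV) summable_on UNIV"
    using assms(1) by (intro summable_on_cmult_left)
qed (use assms in auto)

lemma summable_on_small_tail:
  fixes f :: "'a \<Rightarrow> real"
  assumes "f summable_on UNIV" "\<epsilon> > 0"
  obtains A where "finite A" "infsum f (- A) < \<epsilon>"
proof -
  obtain A where A: "finite A" "dist (sum f A) (infsum f UNIV) \<le> \<epsilon> / 2"
    using infsum_finite_approximation[OF assms(1), of "\<epsilon> / 2"] assms(2) by auto
  have "infsum f UNIV = infsum f A + infsum f (- A)"
    using infsum_Un_disjoint[of f A "- A"] A(1) summable_on_subset_banach[OF assms(1)]
    by simp
  with A assms(2) have "infsum f (- A) < \<epsilon>"
    by (simp add: dist_real_def)
  with A(1) that show ?thesis by blast
qed

definition mat_vec :: "('i \<Rightarrow> 'i \<Rightarrow> complex) \<Rightarrow> ('i \<Rightarrow> complex) \<Rightarrow> 'i \<Rightarrow> complex" where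
  "mat_vec M x k = (\<Sum>\<^sub>\<infinity>j. M k j * x j)"

text \<open>
  The entry bound says that the columns, each weighted and divided by the weight of its index, are
  dominated entry by entry by one summable sequence. It makes \<open>M\<close> a norm limit of its truncations to finitely
  many rows, hence compact. Ordering the indices by a
  level, rather than numbering them, lets \<open>k\<close> and \<open>- k\<close> have equal rank when the indices are integers.
\<close>

locale triangular_matrix =
  fixes w a :: "'i \<Rightarrow> real" and level :: "'i \<Rightarrow> nat" and M :: "'i \<Rightarrow> 'i \<Rightarrow> complex"
  assumes w_pos: "\<And>k. 0 < w k"
    and a_summable: "a summable_on UNIV"
    and entry_bound: "\<And>k j. w k * cmod (M k j) \<le> a k * w j"
    and triangular: "\<And>k j. M k j \<noteq> 0 \<Longrightarrow> k = j \<or> level k < level j"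
    and finite_level: "\<And>n. finite {k. level k < n}"
begin

definition wl1 :: "('i \<Rightarrow> complex) \<Rightarrow> bool" where
  "wl1 x \<longleftrightarrow> (\<lambda>k. w k * cmod (x k)) summable_on UNIV"

definition wnorm :: "('i \<Rightarrow> complex) \<Rightarrow> real" where
  "wnorm x = (\<Sum>\<^sub>\<infinity>k. w k * cmod (x k))"

lemma a_nonneg: "0 \<le> a k"
proof -
  have "0 \<le> a k * w k"
    by (rule order_trans[OF _ entry_bound]) (simp add: w_pos less_imp_le)
  then show ?thesis using w_pos[of k] by (simp add: zero_le_mult_iff)
qed

lemma wl1_add: "wl1 x \<Longrightarrow> wl1 y \<Longrightarrow> wl1 (\<lambda>k. x k + y k)"
  unfolding wl1_def
  by (rule summable_on_comparison_test[where f = "\<lambda>k. w k * cmod (x k) + w k * cmod (y k)"])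
     (simp_all add: summable_on_add mult_left_mono w_pos less_imp_le norm_triangle_ineq flip: distrib_left,
      simp add: summable_on_add distrib_left)

lemma wl1_scale: "wl1 x \<Longrightarrow> wl1 (\<lambda>k. c * x k)"
  using summable_on_cmult_right[of "\<lambda>k. w k * cmod (x k)" UNIV "cmod c"]
  unfolding wl1_def by (simp add: norm_mult mult_ac)

lemma wl1_finite_support: "finite {k. x k \<noteq> 0} \<Longrightarrow> wl1 x"
  unfolding wl1_def by (rule finite_nonzero_values_imp_summable_on) (auto elim: finite_subset[rotated])

lemma wl1_sum: "finite A \<Longrightarrow> (\<And>i. i \<in> A \<Longrightarrow> wl1 (f i)) \<Longrightarrow> wl1 (\<lambda>k. \<Sum>i\<in>A. f i k)"
  by (induction A rule: finite_induct) (auto intro: wl1_add wl1_finite_support)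

lemma product_summable:
  assumes "wl1 x"
  shows "(\<lambda>(k, j). w k * cmod (M k j * x j)) summable_on UNIV \<times> UNIV"
proof (rule summable_on_comparison_test)
  show "(\<lambda>(k, j). a k * (w j * cmod (x j))) summable_on UNIV \<times> UNIV"
    using assms a_nonneg w_pos
    by (intro summable_on_product a_summable) (auto simp: wl1_def less_imp_le)
  show "(case p of (k, j) \<Rightarrow> w k * cmod (M k j * x j)) \<le> (case p of (k, j) \<Rightarrow> a k * (w j * cmod (x j)))"
    for p
    using mult_right_mono[OF entry_bound[of "fst p" "snd p"], of "cmod (x (snd p))"]
    by (cases p) (simp add: norm_mult mult_ac)
qed (auto simp: w_pos less_imp_le)

lemma row_summable:
  assumes "wl1 x"
  shows "(\<lambda>j. cmod (M k j * x j)) summable_on UNIV" "(\<lambda>j. M k j * x j) summable_on UNIV"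
proof -
  have "(\<lambda>j. w k * cmod (M k j * x j)) summable_on UNIV"
    using summable_on_SigmaD1[OF product_summable[OF assms], of k] by simp
  then show *: "(\<lambda>j. cmod (M k j * x j)) summable_on UNIV"
    using w_pos[of k] by (simp add: summable_on_cmult_right')
  show "(\<lambda>j. M k j * x j) summable_on UNIV"
    using * by (rule abs_summable_summable)
qed

lemma wl1_mat_vec:
  assumes "wl1 x" shows "wl1 (mat_vec M x)"
  unfolding wl1_def
proof (rule summable_on_comparison_test)
  show "(\<lambda>k. \<Sum>\<^sub>\<infinity>j. w k * cmod (M k j * x j)) summable_on UNIV"
    using summable_on_Sigma_banach[OF product_summable[OF assms]] by simp
  show "w k * cmod (mat_vec M x k) \<le> (\<Sum>\<^sub>\<infinity>j. w k * cmod (M k j * x j))" for k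
    unfolding mat_vec_def infsum_cmult_right'
    using norm_infsum_bound[OF row_summable(1)[OF assms]] w_pos
    by (intro mult_left_mono) (auto simp: less_imp_le)
qed (auto simp: w_pos less_imp_le)

lemma mat_vec_add: "wl1 x \<Longrightarrow> wl1 y \<Longrightarrow> mat_vec M (\<lambda>k. x k + y k) k = mat_vec M x k + mat_vec M y k"
  unfolding mat_vec_def distrib_left by (intro infsum_add row_summable)

lemma mat_vec_scale: "mat_vec M (\<lambda>k. c * x k) k = c * mat_vec M x k"
  unfolding mat_vec_def by (subst infsum_cmult_right'[symmetric]) (simp add: mult_ac)

lemma mat_vec_sum:
  "finite A \<Longrightarrow> (\<And>i. i \<in> A \<Longrightarrow> wl1 (f i)) \<Longrightarrow>
    mat_vec M (\<lambda>k. \<Sum>i\<in>A. f i k) k = (\<Sum>i\<in>A. mat_vec M (f i) k)"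
proof (induction A rule: finite_induct)
  case empty
  then show ?case by (simp add: mat_vec_def)
next
  case (insert i A)
  then show ?case by (simp add: mat_vec_add wl1_sum)
qed

lemma mat_vec_unit: "mat_vec M (\<lambda>k. if k = j then 1 else 0) k = M k j"
proof -
  have "mat_vec M (\<lambda>k. if k = j then 1 else 0) k = (\<Sum>\<^sub>\<infinity>i\<in>{j}. M k i)"
    unfolding mat_vec_def by (rule infsum_cong_neutral) auto
  then show ?thesis by simp
qed

text \<open>
  The diagonal entries are dominated by the summable sequence \<open>a\<close>, so they accumulate only at \<open>0\<close>.
\<close>

lemma diagonal_gap:
  assumes "\<zeta> \<noteq> 0" "\<And>k. \<zeta> \<noteq> M k k"
  obtains g where "g > 0" "\<And>k. g \<le> cmod (\<zeta> - M k k)"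
proof -
  obtain A where A: "finite A" "infsum a (- A) < cmod \<zeta> / 2"
    using summable_on_small_tail[OF a_summable, of "cmod \<zeta> / 2"] assms(1) by auto
  let ?g = "Min (insert (cmod \<zeta> / 2) ((\<lambda>k. cmod (\<zeta> - M k k)) ` A))"
  have "?g \<le> cmod (\<zeta> - M k k)" for k
  proof (cases "k \<in> A")
    case False
    have "cmod (M k k) \<le> a k"
      using entry_bound[of k k] w_pos[of k] by (simp add: mult.commute)
    also have "\<dots> \<le> infsum a (- A)"
      using finite_sum_le_infsum[of a "- A" "{k}"] False a_nonneg
      by (simp add: summable_on_subset_banach[OF a_summable])
    finally have "cmod \<zeta> / 2 \<le> cmod \<zeta> - cmod (M k k)" using A(2) by simp
    also have "\<dots> \<le> cmod (\<zeta> - M k k)" by (rule norm_triangle_ineq2)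
    finally have "cmod \<zeta> / 2 \<le> cmod (\<zeta> - M k k)" .
    moreover have "?g \<le> cmod \<zeta> / 2" using A(1) by (intro Min_le) auto
    ultimately show ?thesis by linarith
  qed (use A(1) in auto)
  moreover have "?g > 0" using A(1) assms by auto
  ultimately show ?thesis using that by blast
qed

text \<open>
  This is the device that replaces Riesz theory. Multiplying the weight at a low level by a high power of
  a small \<open>\<delta>\<close> makes each index cheap compared with all those of larger level, so the entries
  above the diagonal, which lead from large to small levels, become small in the new norm. Beyond level
  \<open>n\<close> the factor is \<open>1\<close>, and the entries are small there because the tail of \<open>a\<close> is; so
  the new norm is equivalent to the old one.
\<close>

lemma damping_weights:
  assumes "\<epsilon> > 0"
  obtains s :: "'i \<Rightarrow> real" and c where "c > 0" "\<And>k. c \<le> s k" "\<And>k. s k \<le> 1"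
    "\<And>j. (\<Sum>\<^sub>\<infinity>k\<in>{k. level k < level j}. a k * s k) \<le> \<epsilon> * s j"
proof -
  obtain A where A: "finite A" "infsum a (- A) < \<epsilon> / 2"
    using summable_on_small_tail[OF a_summable, of "\<epsilon> / 2"] assms by auto
  obtain n where n: "\<And>k. k \<in> A \<Longrightarrow> level k < n"
    using finite_nat_bounded[of "level ` A"] A(1) by auto
  define S where "S = infsum a UNIV"
  have S: "S \<ge> 0" unfolding S_def by (intro infsum_nonneg a_nonneg)
  have partial: "infsum a B \<le> S" for B
    unfolding S_def
    by (rule infsum_mono2) (auto simp: a_nonneg a_summable summable_on_subset_banach[OF a_summable])
  \<comment> \<open>The constant \<open>\<delta>\<close> is chosen so that indices of level below \<open>n\<close> contribute at most \<open>\<epsilon> / 2\<close>.\<close>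
  obtain \<delta> where \<delta>: "0 < \<delta>" "\<delta> \<le> 1" "\<delta> * S \<le> \<epsilon> / 2"
  proof
    show "0 < min 1 (\<epsilon> / 2 / (S + 1))" using assms S by simp
    have "min 1 (\<epsilon> / 2 / (S + 1)) * S \<le> \<epsilon> / 2 / (S + 1) * S"
      using S by (intro mult_right_mono) auto
    also have "\<dots> \<le> \<epsilon> / 2" using S assms by (simp add: field_simps)
    finally show "min 1 (\<epsilon> / 2 / (S + 1)) * S \<le> \<epsilon> / 2" .
  qed auto
  define s where "s k = \<delta> ^ (n - level k)" for k
  have s_pos: "0 < s k" and s_le: "s k \<le> 1" for k
    using \<delta> by (auto simp: s_def power_le_one)
  have as_summable: "(\<lambda>k. a k * s k) summable_on B" for B
    by (rule summable_on_comparison_test[OF summable_on_subset_banach[OF a_summable]])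
       (use s_pos s_le a_nonneg in \<open>auto intro: mult_left_le simp: less_imp_le\<close>)
  have "(\<Sum>\<^sub>\<infinity>k\<in>{k. level k < level j}. a k * s k) \<le> \<epsilon> * s j" for j
  proof (cases "level j \<le> n")
    case True
    have "s k \<le> \<delta> * s j" if "level k < level j" for k
      using power_decreasing[of "Suc (n - level j)" "n - level k" \<delta>] that True \<delta>
      by (simp add: s_def)
    then have "(\<Sum>\<^sub>\<infinity>k\<in>{k. level k < level j}. a k * s k) \<le> (\<Sum>\<^sub>\<infinity>k\<in>{k. level k < level j}. a k * (\<delta> * s j))"
      using a_nonneg a_summable
      by (intro infsum_mono as_summable summable_on_cmult_left)
         (auto intro: mult_left_mono summable_on_subset_banach)
    also have "\<dots> = infsum a {k. level k < level j} * (\<delta> * s j)"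
      by (rule infsum_cmult_left')
    also have "\<dots> \<le> S * (\<delta> * s j)"
      using partial \<delta> s_pos[of j] by (intro mult_right_mono) auto
    also have "\<dots> \<le> \<epsilon> * s j"
      using mult_right_mono[OF \<delta>(3), of "s j"] s_pos[of j] assms
      by (simp add: mult_ac)
    finally show ?thesis .
  next
    case False
    have le: "s k \<le> \<delta>" if "level k < n" for k
      using power_decreasing[of 1 "n - level k" \<delta>] that \<delta> by (simp add: s_def)
    let ?A = "{k. level k < n}" and ?B = "{k. n \<le> level k \<and> level k < level j}"
    have levels: "{k. level k < level j} = ?A \<union> ?B" using False by auto
    have "(\<Sum>\<^sub>\<infinity>k\<in>{k. level k < level j}. a k * s k)
        = (\<Sum>\<^sub>\<infinity>k\<in>?A. a k * s k) + (\<Sum>\<^sub>\<infinity>k\<in>?B. a k * s k)"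
      unfolding levels by (rule infsum_Un_disjoint[OF as_summable as_summable]) auto
    moreover have "(\<Sum>\<^sub>\<infinity>k\<in>?A. a k * s k) \<le> (\<Sum>\<^sub>\<infinity>k\<in>?A. a k * \<delta>)"
    proof (rule infsum_mono)
      show "(\<lambda>k. a k * \<delta>) summable_on ?A"
        using summable_on_subset_banach[OF a_summable] by (intro summable_on_cmult_left) auto
      show "a k * s k \<le> a k * \<delta>" if "k \<in> ?A" for k
        using a_nonneg le that by (intro mult_left_mono) auto
    qed (rule as_summable)
    moreover have "(\<Sum>\<^sub>\<infinity>k\<in>?A. a k * \<delta>) = infsum a ?A * \<delta>"
      by (rule infsum_cmult_left')
    moreover have "infsum a ?A * \<delta> \<le> S * \<delta>"
      using partial \<delta> by (intro mult_right_mono) auto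
    moreover have "(\<Sum>\<^sub>\<infinity>k\<in>?B. a k * s k) \<le> infsum a (- A)"
    proof (rule infsum_mono_neutral)
      show "a summable_on - A"
        using summable_on_subset_banach[OF a_summable] by auto
      show "a k * s k \<le> a k" if "k \<in> ?B \<inter> - A" for k
        using a_nonneg s_le by (intro mult_left_le) auto
      show "a k * s k \<le> 0" if "k \<in> ?B - - A" for k
        using n[of k] that by auto
    qed (use a_nonneg as_summable in auto)
    ultimately have "(\<Sum>\<^sub>\<infinity>k\<in>{k. level k < level j}. a k * s k) \<le> \<epsilon>"
      using \<delta>(3) A(2) by (simp add: mult.commute)
    then show ?thesis using False by (simp add: s_def)
  qed
  moreover have "\<delta> ^ n \<le> s k" for k
    unfolding s_def using \<delta> by (intro power_decreasing) auto
  ultimately show ?thesis using that[of "\<delta> ^ n" s] \<delta>(1) s_le by simp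
qed

text \<open>
  In the damped norm the diagonal part of \<open>\<zeta> - M\<close> is bounded below by the gap \<open>g\<close>, and the rest of \<open>M\<close>
  has norm at most \<open>g / 2\<close>.
\<close>

lemma resolvent_estimate:
  assumes "\<zeta> \<noteq> 0" "\<And>k. \<zeta> \<noteq> M k k"
  obtains C where "C \<ge> 0" "\<And>x. wl1 x \<Longrightarrow> wnorm x \<le> C * wnorm (\<lambda>k. \<zeta> * x k - mat_vec M x k)"
proof -
  obtain g where g: "g > 0" "\<And>k. g \<le> cmod (\<zeta> - M k k)"
    using diagonal_gap[OF assms] by blast
  obtain s :: "'i \<Rightarrow> real" and c where s: "c > 0" "\<And>k. c \<le> s k" "\<And>k. s k \<le> 1"
    "\<And>j. (\<Sum>\<^sub>\<infinity>k\<in>{k. level k < level j}. a k * s k) \<le> g / 2 * s j"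
    using damping_weights[of "g / 2"] g(1) by (metis half_gt_zero)
  have s_pos: "0 < s k" for k using s(1) s(2)[of k] by linarith
  have "wnorm x \<le> 2 / (g * c) * wnorm (\<lambda>k. \<zeta> * x k - mat_vec M x k)" if x: "wl1 x" for x
  proof -
    define y where "y k = \<zeta> * x k - mat_vec M x k" for k
    have y: "wl1 y"
      using wl1_add[OF wl1_scale[OF x, of \<zeta>] wl1_scale[OF wl1_mat_vec[OF x], of "-1"]]
      by (simp add: y_def[abs_def])
    \<comment> \<open>Dominates the entries off the diagonal, weighted by \<open>s k * w k\<close> and applied to \<open>x\<close>.\<close>
    define B where "B k j = (if level k < level j then a k * s k * (w j * cmod (x j)) else 0)" for k j
    have damp: "(\<lambda>k. s k * (w k * cmod (z k))) summable_on UNIV" if "wl1 z" for z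
      using that unfolding wl1_def
      by (rule summable_on_comparison_test)
         (use s(3) s_pos w_pos in \<open>auto intro!: mult_left_le_one_le simp: less_imp_le\<close>)
    have B_summable: "(\<lambda>(k, j). B k j) summable_on UNIV \<times> UNIV"
    proof (rule summable_on_comparison_test)
      show "(\<lambda>(k, j). a k * (w j * cmod (x j))) summable_on UNIV \<times> UNIV"
        using x a_nonneg w_pos
        by (intro summable_on_product a_summable) (auto simp: wl1_def less_imp_le)
      show "(case p of (k, j) \<Rightarrow> B k j) \<le> (case p of (k, j) \<Rightarrow> a k * (w j * cmod (x j)))" for p
      proof (cases p)
        case (Pair k j)
        have "a k * s k \<le> a k" using a_nonneg s(3) by (intro mult_left_le) auto
        then have "a k * s k * (w j * cmod (x j)) \<le> a k * (w j * cmod (x j))"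
          using w_pos by (intro mult_right_mono) (auto simp: less_imp_le)
        then show ?thesis
          using Pair a_nonneg[of k] w_pos[of j] by (simp add: B_def less_imp_le)
      qed
    qed (auto simp: B_def a_nonneg s_pos w_pos less_imp_le)
    have row: "g * (s k * (w k * cmod (x k))) \<le> s k * (w k * cmod (y k)) + (\<Sum>\<^sub>\<infinity>j. B k j)" for k
    proof -
      have split: "mat_vec M x k = M k k * x k + (\<Sum>\<^sub>\<infinity>j\<in>-{k}. M k j * x j)"
        unfolding mat_vec_def
        using infsum_Un_disjoint[of "\<lambda>j. M k j * x j" "{k}" "-{k}"]
          summable_on_subset_banach[OF row_summable(2)[OF x]] by simp
      have B_row: "B k summable_on UNIV"
        using summable_on_SigmaD1[OF B_summable, of k] by simp
      have abs: "(\<lambda>j. cmod (M k j * x j)) summable_on -{k}"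
        using row_summable(1)[OF x] by (rule summable_on_subset_banach) auto
      have "s k * (w k * cmod (\<Sum>\<^sub>\<infinity>j\<in>-{k}. M k j * x j))
          \<le> s k * (w k * (\<Sum>\<^sub>\<infinity>j\<in>-{k}. cmod (M k j * x j)))"
        using s_pos w_pos norm_infsum_bound[OF abs] by (intro mult_left_mono) (auto simp: less_imp_le)
      also have "\<dots> = (\<Sum>\<^sub>\<infinity>j\<in>-{k}. s k * (w k * cmod (M k j * x j)))"
        by (simp add: infsum_cmult_right')
      also have "\<dots> \<le> (\<Sum>\<^sub>\<infinity>j. B k j)"
      proof (rule infsum_mono_neutral)
        show "B k summable_on UNIV" by (rule B_row)
        show "(\<lambda>j. s k * (w k * cmod (M k j * x j))) summable_on -{k}"
          using abs by (intro summable_on_cmult_right)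
        show "s k * (w k * cmod (M k j * x j)) \<le> B k j" if "j \<in> -{k} \<inter> UNIV" for j
        proof (cases "M k j = 0")
          case True
          then show ?thesis by (auto simp: B_def a_nonneg s_pos w_pos less_imp_le)
        next
          case False
          then have "level k < level j" using triangular[OF False] that by auto
          moreover have "w k * cmod (M k j) * (s k * cmod (x j)) \<le> a k * w j * (s k * cmod (x j))"
            using s_pos[of k] by (intro mult_right_mono entry_bound) auto
          ultimately show ?thesis by (simp add: B_def norm_mult mult_ac)
        qed
      qed (auto simp: B_def a_nonneg s_pos w_pos less_imp_le)
      finally have off: "s k * (w k * cmod (\<Sum>\<^sub>\<infinity>j\<in>-{k}. M k j * x j)) \<le> (\<Sum>\<^sub>\<infinity>j. B k j)" .
      have "g * cmod (x k) \<le> cmod ((\<zeta> - M k k) * x k)"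
        unfolding norm_mult using g(2) by (intro mult_right_mono) auto
      also have "(\<zeta> - M k k) * x k = y k + (\<Sum>\<^sub>\<infinity>j\<in>-{k}. M k j * x j)"
        using split by (simp add: y_def algebra_simps)
      also have "cmod \<dots> \<le> cmod (y k) + cmod (\<Sum>\<^sub>\<infinity>j\<in>-{k}. M k j * x j)"
        by (rule norm_triangle_ineq)
      finally have "s k * w k * (g * cmod (x k))
          \<le> s k * w k * (cmod (y k) + cmod (\<Sum>\<^sub>\<infinity>j\<in>-{k}. M k j * x j))"
        using s_pos w_pos by (intro mult_left_mono) (auto simp: less_imp_le)
      with off show ?thesis by (simp add: algebra_simps)
    qed
    have col: "(\<Sum>\<^sub>\<infinity>k. B k j) \<le> g / 2 * (s j * (w j * cmod (x j)))" for j
    proof -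
      have "(\<Sum>\<^sub>\<infinity>k. B k j) = (\<Sum>\<^sub>\<infinity>k\<in>{k. level k < level j}. a k * s k * (w j * cmod (x j)))"
        by (rule infsum_cong_neutral) (auto simp: B_def)
      also have "\<dots> = (\<Sum>\<^sub>\<infinity>k\<in>{k. level k < level j}. a k * s k) * (w j * cmod (x j))"
        by (rule infsum_cmult_left')
      also have "\<dots> \<le> g / 2 * s j * (w j * cmod (x j))"
        using s(4) w_pos by (intro mult_right_mono) (auto simp: less_imp_le)
      finally show ?thesis by (simp add: mult_ac)
    qed
    let ?sn = "\<lambda>z. \<Sum>\<^sub>\<infinity>k. s k * (w k * cmod (z k))"
    have "g * ?sn x = (\<Sum>\<^sub>\<infinity>k. g * (s k * (w k * cmod (x k))))"
      by (simp add: infsum_cmult_right')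
    also have "\<dots> \<le> (\<Sum>\<^sub>\<infinity>k. s k * (w k * cmod (y k)) + (\<Sum>\<^sub>\<infinity>j. B k j))"
      using damp[OF x] damp[OF y] summable_on_Sigma_banach[OF B_summable]
      by (intro infsum_mono row summable_on_add summable_on_cmult_right) auto
    also have "\<dots> = ?sn y + (\<Sum>\<^sub>\<infinity>k. \<Sum>\<^sub>\<infinity>j. B k j)"
      using damp[OF y] summable_on_Sigma_banach[OF B_summable] by (intro infsum_add) auto
    also have "(\<Sum>\<^sub>\<infinity>k. \<Sum>\<^sub>\<infinity>j. B k j) = (\<Sum>\<^sub>\<infinity>j. \<Sum>\<^sub>\<infinity>k. B k j)"
      by (rule infsum_swap_banach[OF B_summable])
    also have "\<dots> \<le> (\<Sum>\<^sub>\<infinity>j. g / 2 * (s j * (w j * cmod (x j))))"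
    proof (intro infsum_mono col)
      have "(\<lambda>(j, k). B k j) summable_on UNIV \<times> UNIV"
        using B_summable by (subst (asm) summable_on_swap) simp
      then show "(\<lambda>j. \<Sum>\<^sub>\<infinity>k. B k j) summable_on UNIV"
        using summable_on_Sigma_banach[of "\<lambda>j k. B k j" UNIV "\<lambda>_. UNIV"] by simp
    qed (intro summable_on_cmult_right damp[OF x])
    also have "\<dots> = g / 2 * ?sn x"
      by (rule infsum_cmult_right')
    finally have main: "g / 2 * ?sn x \<le> ?sn y" by simp
    have "c * wnorm x = (\<Sum>\<^sub>\<infinity>k. c * (w k * cmod (x k)))"
      by (simp add: wnorm_def infsum_cmult_right')
    also have "\<dots> \<le> ?sn x"
      using x w_pos s(2) unfolding wl1_def
      by (intro infsum_mono damp[OF x[unfolded wl1_def[symmetric]]] summable_on_cmult_right mult_right_mono)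
         (auto simp: less_imp_le wl1_def)
    finally have "g / 2 * (c * wnorm x) \<le> g / 2 * ?sn x"
      using g(1) by (intro mult_left_mono) auto
    also have "\<dots> \<le> ?sn y" by (rule main)
    also have "\<dots> \<le> wnorm y"
      unfolding wnorm_def using y w_pos s(3) s_pos
      by (intro infsum_mono damp[OF y] mult_left_le_one_le) (auto simp: less_imp_le wl1_def)
    finally have "g / 2 * (c * wnorm x) \<le> wnorm y" .
    then show ?thesis using g(1) s(1) by (simp add: y_def[abs_def] field_simps)
  qed
  then show ?thesis using that[of "2 / (g * c)"] g(1) s(1) by simp
qed

lemma injective:
  assumes "\<zeta> \<noteq> 0" "\<And>k. \<zeta> \<noteq> M k k" "wl1 x" "\<And>k. \<zeta> * x k = mat_vec M x k"
  shows "x k = 0"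
proof -
  obtain C where "C \<ge> 0" "wnorm x \<le> C * wnorm (\<lambda>k. \<zeta> * x k - mat_vec M x k)"
    using resolvent_estimate[OF assms(1,2)] assms(3) by metis
  then have "wnorm x \<le> 0" using assms(4) by (simp add: wnorm_def)
  then have "w k * cmod (x k) = 0"
    using assms(3) w_pos unfolding wnorm_def wl1_def
    by (intro nonneg_infsum_le_0D[where A = UNIV]) (auto simp: less_imp_le)
  then show ?thesis using w_pos[of k] by simp
qed

text \<open>
  The vectors supported below a given level form a finite-dimensional invariant subspace, on which
  \<open>\<zeta> - M\<close> can be inverted by back substitution.
\<close>

lemma unit_vector_preimage:
  assumes "\<And>k. \<zeta> \<noteq> M k k"
  shows "\<exists>x. finite {k. x k \<noteq> 0} \<and> (\<forall>k. \<zeta> * x k - mat_vec M x k = (if k = j then 1 else 0))"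
proof (induction "level j" arbitrary: j rule: less_induct)
  case less
  let ?K = "{k. level k < level j}"
  let ?e = "\<lambda>j k. if k = j then 1 else 0 :: complex"
  obtain X where X: "\<And>i. i \<in> ?K \<Longrightarrow> finite {k. X i k \<noteq> 0}"
    "\<And>i k. i \<in> ?K \<Longrightarrow> \<zeta> * X i k - mat_vec M (X i) k = ?e i k"
    using less by (auto simp: Bex_def) metis
  define z where "z k = ?e j k + (\<Sum>i\<in>?K. M i j * X i k)" for k
  define x where "x k = inverse (\<zeta> - M j j) * z k" for k
  note fin = finite_level[of "level j"]
  have supp: "finite {k. x k \<noteq> 0}"
  proof (rule finite_subset)
    show "{k. x k \<noteq> 0} \<subseteq> {j} \<union> (\<Union>i\<in>?K. {k. X i k \<noteq> 0})"
      by (auto simp: x_def z_def split: if_splits elim!: sum.not_neutral_contains_not_neutral)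
  qed (use fin X(1) in auto)
  have "\<zeta> * x k - mat_vec M x k = ?e j k" for k
  proof -
    have wl: "wl1 (\<lambda>k. M i j * X i k)" if "i \<in> ?K" for i
      by (intro wl1_scale wl1_finite_support X that)
    have "mat_vec M z k = mat_vec M (?e j) k + mat_vec M (\<lambda>k. \<Sum>i\<in>?K. M i j * X i k) k"
      unfolding z_def[abs_def] using fin wl
      by (intro mat_vec_add wl1_sum) (auto intro: wl1_finite_support)
    also have "mat_vec M (\<lambda>k. \<Sum>i\<in>?K. M i j * X i k) k = (\<Sum>i\<in>?K. M i j * mat_vec M (X i) k)"
      using mat_vec_sum[of ?K "\<lambda>i k. M i j * X i k" k] fin wl by (simp add: mat_vec_scale)
    finally have "mat_vec M z k = M k j + (\<Sum>i\<in>?K. M i j * mat_vec M (X i) k)"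
      by (simp add: mat_vec_unit)
    then have "\<zeta> * z k - mat_vec M z k = \<zeta> * ?e j k - M k j + (\<Sum>i\<in>?K. M i j * (\<zeta> * X i k - mat_vec M (X i) k))"
      by (simp add: z_def algebra_simps sum_distrib_left sum_subtractf)
    also have "(\<Sum>i\<in>?K. M i j * (\<zeta> * X i k - mat_vec M (X i) k)) = (\<Sum>i\<in>?K. M i j * ?e i k)"
      using X(2) by (intro sum.cong) auto
    also have "\<dots> = (if level k < level j then M k j else 0)"
      using fin by (simp add: if_distrib cong: if_cong)
    also have "\<zeta> * ?e j k - M k j + \<dots> = (\<zeta> - M j j) * ?e j k"
      using triangular[of k j] by auto
    finally have "\<zeta> * z k - mat_vec M z k = (\<zeta> - M j j) * ?e j k" .
    moreover have "\<zeta> * x k - mat_vec M x k = inverse (\<zeta> - M j j) * (\<zeta> * z k - mat_vec M z k)"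
      unfolding x_def[abs_def] mat_vec_scale by (simp add: algebra_simps)
    ultimately show ?thesis using assms[of j] by simp
  qed
  with supp show ?case by blast
qed

text \<open>
  The preimages of the unit vectors are the columns of a matrix \<open>R\<close>, bounded by the resolvent
  estimate, and \<open>R\<close> applied to \<open>y\<close> is the solution.
\<close>

lemma surjective:
  assumes "\<zeta> \<noteq> 0" "\<And>k. \<zeta> \<noteq> M k k" "wl1 y"
  obtains x where "wl1 x" "\<And>k. \<zeta> * x k - mat_vec M x k = y k"
proof -
  obtain C where C: "C \<ge> 0" "\<And>x. wl1 x \<Longrightarrow> wnorm x \<le> C * wnorm (\<lambda>k. \<zeta> * x k - mat_vec M x k)"
    using resolvent_estimate[OF assms(1,2)] by metis
  obtain R where R: "\<And>j. finite {k. R j k \<noteq> 0}"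
    "\<And>j k. \<zeta> * R j k - mat_vec M (R j) k = (if k = j then 1 else 0)"
    using unit_vector_preimage[of \<zeta>] assms(2) by metis
  have R_wl1: "wl1 (R j)" for j by (intro wl1_finite_support R)
  have R_bound: "wnorm (R j) \<le> C * w j" for j
  proof -
    have "wnorm (\<lambda>k. if k = j then 1 else 0) = (\<Sum>\<^sub>\<infinity>k\<in>{j}. w k)"
      unfolding wnorm_def by (rule infsum_cong_neutral) auto
    then show ?thesis using C(2)[OF R_wl1[of j]] by (simp add: R(2))
  qed
  have dom: "(\<lambda>(j, l). w l * cmod (R j l) * cmod (y j)) summable_on UNIV \<times> UNIV"
  proof (rule summable_on_SigmaI[where g = "\<lambda>j. wnorm (R j) * cmod (y j)"])
    show "((\<lambda>l. case (j, l) of (j, l) \<Rightarrow> w l * cmod (R j l) * cmod (y j)) has_sum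
        wnorm (R j) * cmod (y j)) UNIV" for j
      using R_wl1[of j] unfolding wnorm_def wl1_def by (auto intro!: has_sum_cmult_left)
    show "(\<lambda>j. wnorm (R j) * cmod (y j)) summable_on UNIV"
    proof (rule summable_on_comparison_test)
      show "(\<lambda>j. C * (w j * cmod (y j))) summable_on UNIV"
        using assms(3) by (intro summable_on_cmult_right) (simp add: wl1_def)
      show "wnorm (R j) * cmod (y j) \<le> C * (w j * cmod (y j))" for j
        using mult_right_mono[OF R_bound, of "cmod (y j)"] by (simp add: mult_ac)
    qed (auto simp: wnorm_def w_pos less_imp_le intro!: mult_nonneg_nonneg infsum_nonneg)
  qed (auto simp: w_pos less_imp_le)
  have dom': "(\<lambda>(l, j). w l * cmod (R j l) * cmod (y j)) summable_on UNIV \<times> UNIV"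
    using dom by (subst (asm) summable_on_swap) simp
  have R_row: "(\<lambda>j. cmod (R j l * y j)) summable_on UNIV" for l
  proof -
    have "(\<lambda>j. w l * (cmod (R j l) * cmod (y j))) summable_on UNIV"
      using summable_on_SigmaD1[OF dom', of l] by (simp add: mult_ac)
    then show ?thesis using w_pos[of l] by (simp add: summable_on_cmult_right' norm_mult)
  qed
  define x where "x l = (\<Sum>\<^sub>\<infinity>j. R j l * y j)" for l
  have "wl1 x"
    unfolding wl1_def
  proof (rule summable_on_comparison_test)
    show "(\<lambda>l. \<Sum>\<^sub>\<infinity>j. w l * cmod (R j l) * cmod (y j)) summable_on UNIV"
      using summable_on_Sigma_banach[OF dom'] by simp
    show "w l * cmod (x l) \<le> (\<Sum>\<^sub>\<infinity>j. w l * cmod (R j l) * cmod (y j))" for l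
      using mult_left_mono[OF norm_infsum_bound[OF R_row[of l]], of "w l"] w_pos[of l]
      by (simp add: x_def norm_mult mult.assoc infsum_cmult_right')
  qed (auto simp: w_pos less_imp_le)
  moreover have "\<zeta> * x k - mat_vec M x k = y k" for k
  proof -
    have fub: "(\<lambda>(l, j). M k l * (R j l * y j)) summable_on UNIV \<times> UNIV"
    proof (rule abs_summable_summable, rule Infinite_Sum.abs_summable_on_comparison_test')
      show "(\<lambda>(l, j). a k / w k * (w l * cmod (R j l) * cmod (y j))) summable_on UNIV \<times> UNIV"
        using summable_on_cmult_right[OF dom', of "a k / w k"] by (simp add: case_prod_unfold)
      show "cmod (case p of (l, j) \<Rightarrow> M k l * (R j l * y j)) \<le>
          (case p of (l, j) \<Rightarrow> a k / w k * (w l * cmod (R j l) * cmod (y j)))" for p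
      proof (cases p)
        case (Pair l j)
        have "cmod (M k l) \<le> a k / w k * w l"
          using entry_bound[of k l] w_pos[of k] by (simp add: field_simps)
        then have "cmod (M k l) * (cmod (R j l) * cmod (y j)) \<le> a k / w k * w l * (cmod (R j l) * cmod (y j))"
          by (rule mult_right_mono) auto
        then show ?thesis using Pair by (simp add: norm_mult mult_ac)
      qed
    qed
    have "mat_vec M x k = (\<Sum>\<^sub>\<infinity>l. \<Sum>\<^sub>\<infinity>j. M k l * (R j l * y j))"
      by (simp add: mat_vec_def x_def infsum_cmult_right')
    also have "\<dots> = (\<Sum>\<^sub>\<infinity>j. \<Sum>\<^sub>\<infinity>l. M k l * (R j l * y j))"
      by (rule infsum_swap_banach[OF fub])
    also have "\<dots> = (\<Sum>\<^sub>\<infinity>j. mat_vec M (R j) k * y j)"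
      by (simp add: mat_vec_def infsum_cmult_left' flip: mult.assoc)
    also have "\<dots> = (\<Sum>\<^sub>\<infinity>j. \<zeta> * (R j k * y j) + - (if k = j then y j else 0))"
    proof (rule infsum_cong)
      fix j
      have "mat_vec M (R j) k = \<zeta> * R j k - (if k = j then 1 else 0)"
        using R(2)[of j k] by (simp add: algebra_simps)
      then show "mat_vec M (R j) k * y j = \<zeta> * (R j k * y j) + - (if k = j then y j else 0)"
        by (simp only:) (simp add: algebra_simps)
    qed
    also have "\<dots> = (\<Sum>\<^sub>\<infinity>j. \<zeta> * (R j k * y j)) + (\<Sum>\<^sub>\<infinity>j. - (if k = j then y j else 0))"
      using R_row[of k]
      by (intro infsum_add summable_on_cmult_right abs_summable_summable[OF R_row]
          finite_nonzero_values_imp_summable_on) auto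
    also have "(\<Sum>\<^sub>\<infinity>j. - (if k = j then y j else 0)) = (\<Sum>\<^sub>\<infinity>j\<in>{k}. - y j)"
      by (rule infsum_cong_neutral) auto
    finally have "mat_vec M x k = (\<Sum>\<^sub>\<infinity>j. \<zeta> * (R j k * y j)) - y k" by simp
    then show ?thesis by (simp add: x_def[of k] infsum_cmult_right')
  qed
  ultimately show ?thesis using that by blast
qed

text \<open>
  A vector that \<open>M k0 k0 - M\<close> maps into the line spanned by the eigenvector at \<open>k0\<close> lies on that line.
  Replacing row \<open>k0\<close> of \<open>M\<close> by zero removes \<open>M k0 k0\<close> from the diagonal, and injectivity for the
  new matrix gives the claim.
\<close>

lemma simple_eigenvalue:
  assumes "M k0 k0 \<noteq> 0" "\<And>k. k \<noteq> k0 \<Longrightarrow> M k k \<noteq> M k0 k0" "\<And>k. k \<noteq> k0 \<Longrightarrow> M k k0 = 0"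
    and x: "wl1 x" "\<And>k. k \<noteq> k0 \<Longrightarrow> M k0 k0 * x k = mat_vec M x k"
    and "k \<noteq> k0"
  shows "x k = 0"
proof -
  define M' where "M' k j = (if k = k0 then 0 else M k j)" for k j
  define x' where "x' = x(k0 := 0)"
  interpret M': triangular_matrix w a level M'
    by unfold_locales
       (auto simp: M'_def w_pos a_summable entry_bound finite_level a_nonneg less_imp_le
          dest: triangular split: if_splits)
  have "x' k = 0"
  proof (rule M'.injective)
    show "M k0 k0 \<noteq> 0" "M k0 k0 \<noteq> M' k k" for k
      using assms(1) assms(2)[of k] by (auto simp: M'_def)
    show "wl1 x'"
      using x(1) unfolding wl1_def
      by (rule summable_on_comparison_test) (auto simp: x'_def w_pos less_imp_le)
    show "M k0 k0 * x' k = mat_vec M' x' k" for k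
    proof (cases "k = k0")
      case False
      have "mat_vec M' x' k = mat_vec M x k"
        unfolding mat_vec_def using False assms(3) by (intro infsum_cong) (auto simp: M'_def x'_def)
      then show ?thesis using x(2) False by (simp add: x'_def)
    qed (simp add: mat_vec_def M'_def x'_def)
  qed
  then show ?thesis using assms(6) by (simp add: x'_def)
qed

end

section \<open>Fourier coefficients determine integrable functions on the circle\<close>

abbreviation circ :: "real \<Rightarrow> complex" where "circ \<equiv> circlepath 0 1"

lemma circ_cis: "circ t = cis (2 * pi * t)"
  by (simp add: circlepath cis_conv_exp mult_ac)

lemma circ_nonzero [simp]: "circ t \<noteq> 0"
  by (simp add: circ_cis)

lemma norm_circ [simp]: "cmod (circ t) = 1"
  by (simp add: circ_cis)

lemma circ_add: "circ (s + t) = circ s * circ t"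
  by (simp add: circ_cis cis_mult distrib_left)

lemma circ_of_int [simp]: "circ (of_int n) = 1"
  by (simp add: circ_cis cis_multiple_2pi)

lemma cnj_circ: "cnj (circ t) = inverse (circ t)"
  by (simp add: circ_cis cis_cnj cis_inverse)

lemma circ_eq_iff: "circ s = circ t \<longleftrightarrow> (\<exists>n::int. s = t + of_int n)"
proof
  assume "circ s = circ t"
  then have "exp (of_real (2 * pi * s) * \<i>) = exp (of_real (2 * pi * t) * \<i>)"
    by (simp add: circ_cis cis_conv_exp mult_ac)
  then obtain n :: int where "of_real (2 * pi * s) * \<i> = of_real (2 * pi * t) * \<i> + of_int (2 * n) * pi * \<i>"
    unfolding exp_eq by blast
  then have "2 * pi * s = 2 * pi * t + 2 * n * pi"
    by (auto simp: complex_eq_iff)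
  then have "2 * pi * s = 2 * pi * (t + n)" by (simp add: algebra_simps)
  then have "s = t + n" by (subst (asm) mult_cancel_left) simp
  then show "\<exists>n::int. s = t + of_int n" by blast
next
  assume "\<exists>n::int. s = t + of_int n"
  then show "circ s = circ t" by (auto simp: circ_add)
qed

lemma sphere_circE:
  assumes "z \<in> sphere 0 1"
  obtains t where "z = circ t" "0 \<le> t" "t < 1"
proof
  have "cmod z = 1" using assms by simp
  then show "z = circ (Arg2pi z / (2 * pi))"
    using complex_norm_eq_1_exp[of z] by (simp add: circ_cis cis_conv_exp)
  show "0 \<le> Arg2pi z / (2 * pi)" "Arg2pi z / (2 * pi) < 1"
    using Arg2pi[of z] by auto
qed

lemma continuous_on_circ [continuous_intros]:
  "continuous_on S g \<Longrightarrow> continuous_on S (\<lambda>t. circ (g t))"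
  unfolding circlepath by (intro continuous_intros)

lemma continuous_on_circ_powi [continuous_intros]: "continuous_on S (\<lambda>t. circ t powi k)"
  by (intro continuous_on_power_int continuous_on_circ continuous_on_id) auto

lemma absolutely_integrable_times_continuous:
  fixes u v :: "real \<Rightarrow> complex"
  assumes "u absolutely_integrable_on {a..b}" "continuous_on {a..b} v"
  shows "(\<lambda>t. u t * v t) absolutely_integrable_on {a..b}"
proof -
  have "(\<lambda>t. v t * u t) absolutely_integrable_on {a..b}"
  proof (rule absolutely_integrable_bounded_measurable_product[OF bilinear_times])
    show "v \<in> borel_measurable (lebesgue_on {a..b})"
      using assms(2) by (rule continuous_imp_measurable_on_sets_lebesgue) auto
    show "bounded (v ` {a..b})"
      using assms(2) by (intro compact_imp_bounded compact_continuous_image) auto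
  qed (use assms in auto)
  then show ?thesis by (simp add: mult.commute)
qed

lemma integral_circ_powi:
  "integral {0..1} (\<lambda>t. circ t powi k) = (if k = 0 then 1 else 0)"
proof (cases "k = 0")
  case False
  define F where "F t = exp (2 * pi * \<i> * k * of_real t) / (2 * pi * \<i> * k)" for t :: real
  have powi: "circ t powi k = exp (2 * pi * \<i> * k * of_real t)" for t
    by (simp add: circ_cis cis_conv_exp exp_power_int mult_ac)
  have "((\<lambda>t. circ t powi k) has_integral F 1 - F 0) {0..1}"
    unfolding powi F_def using False
    by (intro fundamental_theorem_of_calculus)
       (auto intro!: derivative_eq_intros has_vector_derivative_real_field)
  moreover have "F 1 = F 0"
    using exp_integer_2pi[of "of_int k"] by (simp add: F_def mult_ac)
  ultimately show ?thesis using False by (simp add: integral_unique)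
qed simp

text \<open>
  All integer powers are included so that the class of such functions is closed under multiplication by \<open>z\<close>
  and \<open>1/z\<close>, hence by real polynomials in \<open>Re z\<close> and \<open>Im z\<close>; the Stone-Weierstrass theorem then
  extends this to continuous functions.
\<close>

definition annihilates_powers :: "(real \<Rightarrow> complex) \<Rightarrow> bool" where
  "annihilates_powers u \<longleftrightarrow> u absolutely_integrable_on {0..1} \<and>
     (\<forall>k::int. integral {0..1} (\<lambda>t. u t * circ t powi k) = 0)"

lemma annihilates_powers_add:
  assumes "annihilates_powers u" "annihilates_powers v"
  shows "annihilates_powers (\<lambda>t. u t + v t)"
proof -
  have "(\<lambda>t. u t * circ t powi k) integrable_on {0..1}" "(\<lambda>t. v t * circ t powi k) integrable_on {0..1}" for k
    using assms unfolding annihilates_powers_def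
    by (intro set_lebesgue_integral_eq_integral(1) absolutely_integrable_times_continuous
        continuous_on_circ_powi; simp)+
  then show ?thesis
    using assms unfolding annihilates_powers_def
    by (auto simp: distrib_right integral_add)
qed

lemma annihilates_powers_mult_powi:
  assumes "annihilates_powers u"
  shows "annihilates_powers (\<lambda>t. c * (u t * circ t powi m))"
proof -
  have "(\<lambda>t. c * (u t * circ t powi m) * circ t powi k) = (\<lambda>t. c * (u t * circ t powi (m + k)))" for k
    by (simp add: power_int_add mult_ac)
  then have "integral {0..1} (\<lambda>t. c * (u t * circ t powi m) * circ t powi k) = 0" for k
    using assms by (simp add: annihilates_powers_def)
  moreover have "(\<lambda>t. u t * circ t powi m) absolutely_integrable_on {0..1}"
    using assms unfolding annihilates_powers_def
    by (intro absolutely_integrable_times_continuous continuous_on_circ_powi) simp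
  ultimately show ?thesis
    unfolding annihilates_powers_def by (simp add: set_integrable_mult_right)
qed

lemma annihilates_powers_mult_polynomial:
  assumes "real_polynomial_function g" "annihilates_powers u"
  shows "annihilates_powers (\<lambda>t. u t * of_real (g (circ t)))"
  using assms
proof (induction arbitrary: u rule: real_polynomial_function.induct)
  case (linear f)
  interpret bounded_linear f by fact
  \<comment> \<open>A real linear form is \<open>z \<mapsto> \<alpha> z + cnj \<alpha> * cnj z\<close>, and \<open>cnj z = 1/z\<close> on the circle.\<close>
  define \<alpha> where "\<alpha> = Complex (f 1) (- f \<i>) / 2"
  have expand: "of_real (f z) = \<alpha> * z + cnj \<alpha> * cnj z" for z
  proof -
    have "f z = f (Re z *\<^sub>R 1 + Im z *\<^sub>R \<i>)"
      by (rule arg_cong[of _ _ f]) (simp add: complex_eq_iff)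
    then have "f z = Re z * f 1 + Im z * f \<i>" by (simp only: add scaleR) simp
    then show ?thesis by (simp add: \<alpha>_def complex_eq_iff field_simps)
  qed
  have "(\<lambda>t. u t * of_real (f (circ t)))
      = (\<lambda>t. \<alpha> * (u t * circ t powi 1) + cnj \<alpha> * (u t * circ t powi -1))"
    by (simp add: expand cnj_circ algebra_simps power_int_minus)
  then show ?case
    by (simp only:) (intro annihilates_powers_add annihilates_powers_mult_powi linear.prems)
next
  case (const c)
  then show ?case using annihilates_powers_mult_powi[of u "of_real c" 0] by (simp add: mult.commute)
next
  case (add f g)
  then show ?case using annihilates_powers_add by (simp add: distrib_left)
next
  case (mult f g)
  from mult.IH(2)[OF mult.IH(1)[OF mult.prems]] show ?case by (simp add: mult_ac)
qed

lemma annihilates_continuous_real: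
  fixes h :: "complex \<Rightarrow> real"
  assumes u: "annihilates_powers u" and h: "continuous_on (sphere 0 1) h"
  shows "integral {0..1} (\<lambda>t. u t * of_real (h (circ t))) = 0"
proof -
  let ?I = "integral {0..1} (\<lambda>t. u t * of_real (h (circ t)))"
  let ?N = "integral {0..1} (\<lambda>t. cmod (u t))"
  have abs: "u absolutely_integrable_on {0..1}"
    using u by (simp add: annihilates_powers_def)
  have N: "(\<lambda>t. cmod (u t)) integrable_on {0..1}"
    using abs by (simp add: absolutely_integrable_on_def)
  have hc: "continuous_on {0..1} (\<lambda>t. h (circ t))"
    by (rule continuous_on_compose2[OF h]) (auto intro: continuous_intros)
  have small: "cmod ?I \<le> \<epsilon> * ?N" if "\<epsilon> > 0" for \<epsilon>
  proof -
    obtain g where g: "real_polynomial_function g" "\<And>z. z \<in> sphere 0 1 \<Longrightarrow> \<bar>h z - g z\<bar> < \<epsilon>"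
      using Stone_Weierstrass_real_polynomial_function[OF _ h \<open>\<epsilon> > 0\<close>] by auto
    have ann: "annihilates_powers (\<lambda>t. u t * of_real (g (circ t)))"
      by (rule annihilates_powers_mult_polynomial[OF g(1) u])
    then have I0: "integral {0..1} (\<lambda>t. u t * of_real (g (circ t))) = 0"
      unfolding annihilates_powers_def by (auto dest: spec[of _ 0])
    have int_g: "(\<lambda>t. u t * of_real (g (circ t))) integrable_on {0..1}"
      using ann unfolding annihilates_powers_def by (blast intro: set_lebesgue_integral_eq_integral(1))
    have int_h: "(\<lambda>t. u t * of_real (h (circ t))) integrable_on {0..1}"
      by (intro set_lebesgue_integral_eq_integral(1) absolutely_integrable_times_continuous abs
          continuous_on_of_real hc)
    have "?I = integral {0..1} (\<lambda>t. u t * of_real (h (circ t)) - u t * of_real (g (circ t)))"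
      using I0 by (simp add: integral_diff[OF int_h int_g])
    also have "cmod \<dots> \<le> integral {0..1} (\<lambda>t. \<epsilon> * cmod (u t))"
    proof (rule integral_norm_bound_integral)
      show "(\<lambda>t. u t * of_real (h (circ t)) - u t * of_real (g (circ t))) integrable_on {0..1}"
        by (intro integrable_diff int_h int_g)
      show "(\<lambda>t. \<epsilon> * cmod (u t)) integrable_on {0..1}"
        using N by (rule integrable_on_mult_right)
      show "cmod (u t * of_real (h (circ t)) - u t * of_real (g (circ t))) \<le> \<epsilon> * cmod (u t)" for t
      proof -
        have "cmod (u t * of_real (h (circ t)) - u t * of_real (g (circ t))) = cmod (u t) * \<bar>h (circ t) - g (circ t)\<bar>"
          by (simp add: norm_mult flip: right_diff_distrib of_real_diff)
        also have "\<dots> \<le> cmod (u t) * \<epsilon>"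
          using g(2)[of "circ t"] by (intro mult_left_mono) auto
        finally show ?thesis by (simp add: mult.commute)
      qed
    qed
    finally show ?thesis by simp
  qed
  have "?N \<ge> 0" by (intro integral_nonneg N) auto
  show ?thesis
  proof (rule ccontr)
    assume "?I \<noteq> 0"
    then have "cmod ?I \<le> cmod ?I / (2 * (?N + 1)) * ?N"
      using \<open>?N \<ge> 0\<close> by (intro small) auto
    moreover have "\<dots> < cmod ?I"
      using \<open>?N \<ge> 0\<close> \<open>?I \<noteq> 0\<close> by (simp add: field_simps add_pos_nonneg)
    ultimately show False by simp
  qed
qed

lemma annihilates_continuous:
  fixes h :: "complex \<Rightarrow> complex"
  assumes u: "annihilates_powers u" and h: "continuous_on (sphere 0 1) h"
  shows "integral {0..1} (\<lambda>t. u t * h (circ t)) = 0"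
proof -
  have abs: "u absolutely_integrable_on {0..1}"
    using u by (simp add: annihilates_powers_def)
  have hc: "continuous_on {0..1} (\<lambda>t. h (circ t))"
    by (rule continuous_on_compose2[OF h]) (auto intro: continuous_intros)
  have int: "(\<lambda>t. u t * of_real (Re (h (circ t)))) integrable_on {0..1}"
    "(\<lambda>t. \<i> * (u t * of_real (Im (h (circ t))))) integrable_on {0..1}"
    by (intro set_lebesgue_integral_eq_integral(1) absolutely_integrable_times_continuous abs
          continuous_on_of_real continuous_intros hc integrable_on_mult_right)+
  have "(\<lambda>t. u t * h (circ t)) = (\<lambda>t. u t * of_real (Re (h (circ t))) + \<i> * (u t * of_real (Im (h (circ t)))))"
    by (rule ext, subst complex_eq[of "h _"]) (simp add: algebra_simps)
  then have "integral {0..1} (\<lambda>t. u t * h (circ t)) =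
      integral {0..1} (\<lambda>t. u t * of_real (Re (h (circ t)))) + \<i> * integral {0..1} (\<lambda>t. u t * of_real (Im (h (circ t))))"
    using int by (simp add: integral_add)
  then show ?thesis
    using annihilates_continuous_real[OF u, of "\<lambda>z. Re (h z)"] annihilates_continuous_real[OF u, of "\<lambda>z. Im (h z)"] h
    by (simp add: continuous_intros)
qed

lemma negligible_nonzero_if_integral_zero:
  fixes f :: "'a::euclidean_space \<Rightarrow> real"
  assumes "f integrable_on S" "integral S f = 0" "\<And>x. x \<in> S \<Longrightarrow> 0 \<le> f x"
  shows "negligible {x \<in> S. f x \<noteq> 0}"
proof -
  have abs: "f absolutely_integrable_on S"
    using assms by (intro nonnegative_absolutely_integrable_1) auto
  then have "integrable lebesgue (\<lambda>x. indicator S x *\<^sub>R f x)"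
    by (simp add: set_integrable_def)
  moreover have "integral\<^sup>L lebesgue (\<lambda>x. indicator S x *\<^sub>R f x) = 0"
    using set_lebesgue_integral_eq_integral(2)[OF abs] assms(2) by (simp add: set_lebesgue_integral_def)
  ultimately have "AE x in lebesgue. indicator S x *\<^sub>R f x = 0"
    using assms(3) by (subst (asm) integral_nonneg_eq_0_iff_AE) (auto simp: indicator_def)
  then obtain N where N: "N \<in> null_sets lebesgue" "{x. indicator S x *\<^sub>R f x \<noteq> 0} \<subseteq> N"
    by (auto simp: eventually_ae_filter)
  then have "negligible N" by (simp add: negligible_iff_null_sets)
  then show ?thesis using N(2) by (rule negligible_subset[OF _ order_trans[rotated]]) (auto simp: indicator_def)
qed

text \<open>
  This is the uniqueness theorem for Fourier coefficients. Measurability provides continuous \<open>g n\<close> that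
  converge to \<open>u\<close> almost everywhere. Testing \<open>u\<close> against the bounded continuous function \<open>\<phi> (g n)\<close>
  with \<open>\<phi> z = cnj z / (1 + \<bar>z\<bar>)\<close> and passing to the limit shows that the integral of
  \<open>\<bar>u\<bar>\<^sup>2 / (1 + \<bar>u\<bar>)\<close> is zero.
\<close>

lemma annihilates_powers_imp_zero_ae:
  assumes u: "annihilates_powers u"
  shows "negligible {t \<in> {0..1}. u t \<noteq> 0}"
proof -
  have abs: "u absolutely_integrable_on {0..1}"
    using u by (simp add: annihilates_powers_def)
  then have "u \<in> borel_measurable (lebesgue_on {0..1})"
    by (rule absolutely_integrable_imp_borel_measurable) auto
  then have "u measurable_on {0..1}"
    by (simp add: measurable_on_iff_borel_measurable)
  then obtain N g where N: "negligible N" and g: "\<And>n. continuous_on UNIV (g n)"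
    "\<And>t. t \<notin> N \<Longrightarrow> (\<lambda>n. g n t) \<longlonglongrightarrow> (if t \<in> {0..1} then u t else 0)"
    unfolding measurable_on_def by blast
  define \<phi> :: "complex \<Rightarrow> complex" where "\<phi> z = cnj z / of_real (1 + cmod z)" for z
  have \<phi>_cont: "continuous_on S \<phi>" for S
  proof -
    have "1 + cmod z \<noteq> 0" for z using norm_ge_zero[of z] by linarith
    then have "of_real (1 + cmod z) \<noteq> (0::complex)" for z by (simp only: of_real_eq_0_iff) simp
    then show ?thesis unfolding \<phi>_def by (intro continuous_intros) auto
  qed
  have \<phi>_bound: "cmod (\<phi> z) \<le> 1" for z
  proof -
    have "cmod (\<phi> z) = cmod z / (1 + cmod z)"
      unfolding \<phi>_def norm_divide norm_of_real by simp
    also have "\<dots> \<le> 1" by (simp add: divide_le_eq_1 add_pos_nonneg)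
    finally show ?thesis .
  qed
  have mult_\<phi>: "z * \<phi> z = of_real ((cmod z)\<^sup>2 / (1 + cmod z))" for z
    by (simp add: \<phi>_def flip: complex_norm_square)
  \<comment> \<open>The function \<open>g n\<close> of the angle need not be continuous on the circle at \<open>z = 1\<close>, where the angle jumps.
    The factor \<open>cut n\<close> vanishes there and tends to \<open>1\<close> elsewhere.\<close>
  define cut where "cut n z = min 1 (real n * cmod (z - 1))" for n z
  have cut_bound: "\<bar>cut n z\<bar> \<le> 1" for n z by (auto simp: cut_def min_def)
  define h where "h n z = of_real (cut n z) * \<phi> (g n (Arg2pi z / (2 * pi)))" for n z
  have Arg_circ: "Arg2pi (circ t) / (2 * pi) = t" if "0 \<le> t" "t < 1" for t
    using that Arg2pi_exp[of "\<i> * of_real (2 * pi * t)"] by (simp add: circ_cis cis_conv_exp)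
  have h_cont: "continuous_on (sphere 0 1) (h n)" for n
  proof (rule continuous_at_imp_continuous_on, rule ballI)
    fix z :: complex assume z: "z \<in> sphere 0 1"
    show "isCont (h n) z"
    proof (cases "z = 1")
      case True
      have "(h n \<longlongrightarrow> 0) (at 1)"
      proof (rule Lim_null_comparison)
        have "cmod (h n z) \<le> real n * cmod (z - 1)" for z
        proof -
          have "cmod (h n z) = \<bar>cut n z\<bar> * cmod (\<phi> (g n (Arg2pi z / (2 * pi))))"
            by (simp add: h_def norm_mult)
          also have "\<dots> \<le> \<bar>cut n z\<bar> * 1" by (intro mult_left_mono \<phi>_bound) auto
          also have "\<dots> \<le> real n * cmod (z - 1)" by (simp add: cut_def min_def)
          finally show ?thesis .
        qed
        then show "\<forall>\<^sub>F z in at 1. cmod (h n z) \<le> real n * cmod (z - 1)" by simp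
        have "((\<lambda>z::complex. real n * cmod (z - 1)) \<longlongrightarrow> real n * cmod (1 - 1)) (at 1)"
          by (intro tendsto_intros)
        then show "((\<lambda>z::complex. real n * cmod (z - 1)) \<longlongrightarrow> 0) (at 1)" by simp
      qed
      moreover have "h n 1 = 0" by (simp add: h_def cut_def)
      ultimately show ?thesis using True by (simp add: isCont_def)
    next
      case False
      have "z \<notin> \<real>\<^sub>\<ge>\<^sub>0"
      proof
        assume "z \<in> \<real>\<^sub>\<ge>\<^sub>0"
        then obtain r where "z = of_real r" "r \<ge> 0" by (auto elim: nonneg_Reals_cases)
        then show False using z False by simp
      qed
      then have "isCont Arg2pi z" by (rule continuous_at_Arg2pi)
      then have "isCont (\<lambda>z. Arg2pi z / (2 * pi)) z" by (intro continuous_intros) auto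
      then have "isCont (\<lambda>z. g n (Arg2pi z / (2 * pi))) z"
        by (rule isCont_o2) (use g(1)[of n] in \<open>simp add: continuous_on_eq_continuous_at\<close>)
      then have "isCont (\<lambda>z. \<phi> (g n (Arg2pi z / (2 * pi)))) z"
        by (rule isCont_o2) (use \<phi>_cont[of UNIV] in \<open>simp add: continuous_on_eq_continuous_at\<close>)
      moreover have "isCont (cut n) z"
        unfolding cut_def[abs_def] by (intro continuous_intros)
      ultimately show ?thesis unfolding h_def[abs_def] by (intro continuous_intros)
    qed
  qed
  define f where "f n t = u t * h n (circ t)" for n t
  define F where "F t = (cmod (u t))\<^sup>2 / (1 + cmod (u t))" for t
  let ?S = "{0..1} - (N \<union> {0, 1})"
  have neg: "negligible (N \<union> {0, 1})" using N by simp
  have hc: "continuous_on {0..1} (\<lambda>t. h n (circ t))" for n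
    by (rule continuous_on_compose2[OF h_cont]) (auto intro: continuous_intros)
  have f_int: "f n integrable_on {0..1}" for n
    unfolding f_def
    by (intro set_lebesgue_integral_eq_integral(1) absolutely_integrable_times_continuous abs hc)
  have f_int': "f n integrable_on ?S" for n
    by (rule integrable_spike_set[OF f_int]) (auto intro: negligible_subset[OF neg])
  have f_zero: "integral ?S (f n) = 0" for n
  proof -
    have "integral ?S (f n) = integral {0..1} (f n)"
      by (rule integral_spike_set) (auto intro: negligible_subset[OF neg])
    also have "\<dots> = 0"
      unfolding f_def by (rule annihilates_continuous[OF u h_cont])
    finally show ?thesis .
  qed
  have dom_int: "(\<lambda>t. cmod (u t)) integrable_on ?S"
  proof (rule integrable_spike_set)
    show "(\<lambda>t. cmod (u t)) integrable_on {0..1}"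
      using abs by (simp add: absolutely_integrable_on_def)
  qed (auto intro: negligible_subset[OF neg])
  have bound: "cmod (f n t) \<le> cmod (u t)" for n t
  proof -
    have "cmod (h n (circ t)) \<le> 1"
      unfolding h_def norm_mult norm_of_real using cut_bound \<phi>_bound by (intro mult_le_one) auto
    then show ?thesis unfolding f_def norm_mult by (intro mult_left_le) auto
  qed
  have conv: "(\<lambda>n. f n t) \<longlonglongrightarrow> of_real (F t)" if t: "t \<in> ?S" for t
  proof -
    have t01: "0 < t" "t < 1" "t \<notin> N" using t by auto
    have "circ t \<noteq> circ 0"
    proof
      assume "circ t = circ 0"
      then obtain n :: int where "t = of_int n" by (auto simp: circ_eq_iff)
      with t01 show False by simp
    qed
    then have pos: "cmod (circ t - 1) > 0" using circ_of_int[of 0] by simp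
    have "\<forall>\<^sub>F n in sequentially. cut n (circ t) = 1"
    proof -
      have "\<forall>\<^sub>F n in sequentially. 1 / cmod (circ t - 1) \<le> real n"
        using filterlim_real_sequentially by (simp add: filterlim_at_top)
      then show ?thesis by eventually_elim (use pos in \<open>simp add: cut_def field_simps\<close>)
    qed
    then have "(\<lambda>n. cut n (circ t)) \<longlonglongrightarrow> 1"
      by (rule tendsto_eventually)
    moreover have "(\<lambda>n. \<phi> (g n t)) \<longlonglongrightarrow> \<phi> (u t)"
    proof (rule isCont_tendsto_compose[of _ \<phi>])
      show "isCont \<phi> (u t)" using \<phi>_cont[of UNIV] by (simp add: continuous_on_eq_continuous_at)
      show "(\<lambda>n. g n t) \<longlonglongrightarrow> u t" using g(2)[of t] t01 by simp
    qed
    ultimately have "(\<lambda>n. u t * (of_real (cut n (circ t)) * \<phi> (g n t))) \<longlonglongrightarrow> u t * (of_real 1 * \<phi> (u t))"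
      by (intro tendsto_intros)
    then show ?thesis using Arg_circ[of t] t01 by (simp add: f_def h_def F_def mult_\<phi>)
  qed
  have "(\<lambda>n. integral ?S (f n)) \<longlonglongrightarrow> integral ?S (\<lambda>t. complex_of_real (F t))"
    and int_F: "(\<lambda>t. complex_of_real (F t)) integrable_on ?S"
    using dominated_convergence[OF f_int' dom_int bound conv] by blast+
  then have "integral ?S (\<lambda>t. complex_of_real (F t)) = 0"
    unfolding f_zero LIMSEQ_const_iff by simp
  moreover have "F integrable_on ?S"
    using integrable_linear[OF int_F bounded_linear_Re] by (simp add: o_def)
  moreover from calculation have "integral ?S F = 0"
    using integral_linear[OF int_F bounded_linear_Re] by (simp add: o_def)
  moreover have "0 \<le> F t" for t by (simp add: F_def)
  ultimately have "negligible {t \<in> ?S. F t \<noteq> 0}"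
    by (intro negligible_nonzero_if_integral_zero)
  then have "negligible ({t \<in> ?S. F t \<noteq> 0} \<union> (N \<union> {0, 1}))"
    using neg by (rule negligible_Un)
  then show ?thesis
  proof (rule negligible_subset)
    have "F t \<noteq> 0" if "u t \<noteq> 0" for t
    proof -
      have "1 + cmod (u t) > 0" by (simp add: add_pos_nonneg)
      then show ?thesis using that by (simp add: F_def)
    qed
    then show "{t \<in> {0..1}. u t \<noteq> 0} \<subseteq> {t \<in> ?S. F t \<noteq> 0} \<union> (N \<union> {0, 1})" by auto
  qed
qed

lemma fourier_coeff_abs:
  assumes "integrable_circle f"
  shows "fourier_coeff (abs_L1 f) k = integral {0..1} (\<lambda>t. f (circ t) * circ t powi - k)"
proof -
  have "f (circ t) / circ t powi (k + 1) * vector_derivative circ (at t)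
      = 2 * of_real pi * \<i> * (f (circ t) * circ t powi - k)" for t
  proof -
    have "vector_derivative circ (at t) = 2 * of_real pi * \<i> * circ t"
      by (subst vector_derivative_circlepath) (simp add: circlepath mult_ac)
    then show ?thesis by (simp add: power_int_add power_int_minus field_simps)
  qed
  then have "contour_integral circ (\<lambda>z. f z / z powi (k + 1))
      = 2 * of_real pi * \<i> * integral {0..1} (\<lambda>t. f (circ t) * circ t powi - k)"
    by (simp add: contour_integral_integral)
  moreover have "L1_rel f f" using assms by (simp add: L1_rel_def)
  ultimately show ?thesis by (simp add: fourier_coeff.abs_eq)
qed

lemma integrable_circle_rep: "integrable_circle (rep_L1 f)"
  using Quotient3_rep_reflp[OF Quotient3_L1_circle] by (simp add: L1_rel_def)

lemma abs_rep_L1 [simp]: "abs_L1 (rep_L1 f) = f"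
  by (rule Quotient3_abs_rep[OF Quotient3_L1_circle])

lemma abs_L1_eq_iff:
  "integrable_circle f \<Longrightarrow> integrable_circle g \<Longrightarrow> abs_L1 f = abs_L1 g \<longleftrightarrow> L1_rel f g"
  using Quotient3_rel[OF Quotient3_L1_circle, of f g] by (auto simp: L1_rel_def)

lemma fourier_coeff_rep:
  "fourier_coeff f k = integral {0..1} (\<lambda>t. rep_L1 f (circ t) * circ t powi - k)"
  using fourier_coeff_abs[OF integrable_circle_rep, of f k] by simp

lemma integrable_on_times_powi:
  "integrable_circle f \<Longrightarrow> (\<lambda>t. f (circ t) * circ t powi k) integrable_on {0..1}"
  unfolding integrable_circle_def
  by (intro set_lebesgue_integral_eq_integral(1) absolutely_integrable_times_continuous
      continuous_on_circ_powi)

lemma fourier_coeff_diff: "fourier_coeff (f - g) k = fourier_coeff f k - fourier_coeff g k"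
proof -
  have "f - g = abs_L1 (\<lambda>z. rep_L1 f z - rep_L1 g z)"
    using minus_L1_circle.abs_eq[of "rep_L1 f" "rep_L1 g"] integrable_circle_rep
    by (simp add: L1_rel_def)
  then show ?thesis
    by (simp add: fourier_coeff_abs integrable_circle_intros integrable_circle_rep
        fourier_coeff_rep[of f] fourier_coeff_rep[of g]
        left_diff_distrib integral_diff integrable_on_times_powi)
qed

lemma fourier_coeff_scale: "fourier_coeff (scale_L1 a f) k = a * fourier_coeff f k"
proof -
  have "scale_L1 a f = abs_L1 (\<lambda>z. a * rep_L1 f z)"
    using scale_L1.abs_eq[of "rep_L1 f" a] integrable_circle_rep by (simp add: L1_rel_def)
  then show ?thesis
    by (simp add: fourier_coeff_abs integrable_circle_intros integrable_circle_rep
        fourier_coeff_rep[of f] mult.assoc)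
qed

lemma fourier_coeff_zero [simp]: "fourier_coeff 0 k = 0"
  using fourier_coeff_diff[of 0 0 k] by simp

lemma fourier_coeff_inject:
  assumes "\<And>k. fourier_coeff f k = fourier_coeff g k"
  shows "f = g"
proof -
  define h where "h = f - g"
  have "fourier_coeff h k = 0" for k using assms by (simp add: h_def fourier_coeff_diff)
  then have "integral {0..1} (\<lambda>t. rep_L1 h (circ t) * circ t powi k) = 0" for k
    using fourier_coeff_rep[of h "- k"] by simp
  then have "annihilates_powers (\<lambda>t. rep_L1 h (circ t))"
    using integrable_circle_rep[of h] by (simp add: annihilates_powers_def integrable_circle_def)
  then have "L1_rel (rep_L1 h) (\<lambda>_. 0)"
    using annihilates_powers_imp_zero_ae integrable_circle_rep[of h]
    by (auto simp: L1_rel_def integrable_circle_intros)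
  then have "h = abs_L1 (\<lambda>_. 0)"
    using abs_L1_eq_iff[of "rep_L1 h" "\<lambda>_. 0"] by (simp add: L1_rel_def)
  then have "h = 0" by (simp add: zero_L1_circle_def)
  then show ?thesis by (simp add: h_def)
qed

definition fourier_sum :: "(int \<Rightarrow> complex) \<Rightarrow> complex \<Rightarrow> complex" where
  "fourier_sum c z = (\<Sum>\<^sub>\<infinity>k. c k * z powi k)"

text \<open>
  Both claims follow from the uniform convergence of the series on the circle.
\<close>

lemma fourier_sum_integral:
  fixes c :: "int \<Rightarrow> complex"
  assumes c: "(\<lambda>k. cmod (c k)) summable_on UNIV" and v: "continuous_on {0..1} v"
  shows "continuous_on {0..1} (\<lambda>t. fourier_sum c (circ t))"
    and "((\<lambda>j. c j * integral {0..1} (\<lambda>t. circ t powi j * v t)) has_sum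
      integral {0..1} (\<lambda>t. fourier_sum c (circ t) * v t)) UNIV"
proof -
  have lim: "uniform_limit {0..1} (\<lambda>A t. \<Sum>j\<in>A. c j * circ t powi j)
      (\<lambda>t. fourier_sum c (circ t)) (finite_subsets_at_top UNIV)"
    unfolding fourier_sum_def
    by (rule Weierstrass_m_test_general[OF _ c]) (simp add: norm_mult norm_power_int)
  show cont: "continuous_on {0..1} (\<lambda>t. fourier_sum c (circ t))"
    by (rule uniform_limit_theorem[OF _ lim]) (auto intro!: always_eventually continuous_intros)
  have bdd: "bounded (v ` {0..1})" "bounded ((\<lambda>t. fourier_sum c (circ t)) ` {0..1})"
    using v cont by (auto intro!: compact_imp_bounded compact_continuous_image)
  have "uniform_limit {0..1} (\<lambda>A t. (\<Sum>j\<in>A. c j * circ t powi j) * v t)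
      (\<lambda>t. fourier_sum c (circ t) * v t) (finite_subsets_at_top UNIV)"
    by (rule uniform_lim_mult[OF lim uniform_limit_const bdd(2,1)])
  then obtain I J where I: "\<And>A. ((\<lambda>t. (\<Sum>j\<in>A. c j * circ t powi j) * v t) has_integral I A) {0..1}"
    and J: "((\<lambda>t. fourier_sum c (circ t) * v t) has_integral J) {0..1}"
    and IJ: "(I \<longlongrightarrow> J) (finite_subsets_at_top UNIV)"
    by (rule uniform_limit_integral) (auto intro!: continuous_intros v)
  have "I A = (\<Sum>j\<in>A. c j * integral {0..1} (\<lambda>t. circ t powi j * v t))" for A
  proof (cases "finite A")
    case True
    have int: "(\<lambda>t. circ t powi j * v t) integrable_on {0..1}" for j
      by (intro integrable_continuous_real continuous_intros v)
    have "I A = integral {0..1} (\<lambda>t. \<Sum>j\<in>A. c j * (circ t powi j * v t))"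
      using integral_unique[OF I[of A]] by (simp add: sum_distrib_right mult.assoc)
    then show ?thesis
      using True int by (simp add: integral_sum integrable_on_mult_right)
  next
    case False
    then show ?thesis using integral_unique[OF I[of A]] by simp
  qed
  then have "I = (\<lambda>A. \<Sum>j\<in>A. c j * integral {0..1} (\<lambda>t. circ t powi j * v t))" by blast
  then show "((\<lambda>j. c j * integral {0..1} (\<lambda>t. circ t powi j * v t)) has_sum
      integral {0..1} (\<lambda>t. fourier_sum c (circ t) * v t)) UNIV"
    using IJ integral_unique[OF J] by (simp add: has_sum_def)
qed

lemma fourier_coeff_fourier_sum:
  assumes "(\<lambda>k. cmod (c k)) summable_on UNIV"
  shows "integrable_circle (fourier_sum c)" "fourier_coeff (abs_L1 (fourier_sum c)) k = c k"
proof -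
  show int: "integrable_circle (fourier_sum c)"
    unfolding integrable_circle_def
    by (intro absolutely_integrable_continuous_real fourier_sum_integral(1)[OF assms continuous_on_const])
  have "integral {0..1} (\<lambda>t. circ t powi j * circ t powi - k) = (if j = k then 1 else 0)" for j
    using integral_circ_powi[of "j + - k"] by (simp only: power_int_add circ_nonzero simp_thms) simp
  then have "((\<lambda>j. c j * (if j = k then 1 else 0)) has_sum
      integral {0..1} (\<lambda>t. fourier_sum c (circ t) * circ t powi - k)) UNIV"
    using fourier_sum_integral(2)[OF assms continuous_on_circ_powi, of "- k"] by simp
  moreover have "((\<lambda>j. c j * (if j = k then 1 else 0)) has_sum c k) UNIV"
    by (rule has_sum_finite_neutralI[where B = "{k}"]) auto
  ultimately show "fourier_coeff (abs_L1 (fourier_sum c)) k = c k"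
    unfolding fourier_coeff_abs[OF int] by (rule has_sum_unique)
qed

text \<open>
  An integrable function with summable coefficients agrees almost everywhere with its Fourier series,
  so it can be paired with continuous functions term by term.
\<close>

lemma fourier_pairing:
  assumes f: "(\<lambda>k. cmod (fourier_coeff f k)) summable_on UNIV" and v: "continuous_on {0..1} v"
  shows "integral {0..1} (\<lambda>t. rep_L1 f (circ t) * v t)
    = (\<Sum>\<^sub>\<infinity>j. fourier_coeff f j * integral {0..1} (\<lambda>t. circ t powi j * v t))"
proof -
  let ?s = "fourier_sum (fourier_coeff f)"
  have "abs_L1 ?s = f"
    by (rule fourier_coeff_inject) (rule fourier_coeff_fourier_sum[OF f])
  then have "L1_rel (rep_L1 f) ?s"
    by (subst abs_L1_eq_iff[symmetric])
       (simp_all add: integrable_circle_rep fourier_coeff_fourier_sum[OF f])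
  then have neg: "negligible {t \<in> {0..1}. rep_L1 f (circ t) \<noteq> ?s (circ t)}"
    by (simp add: L1_rel_def)
  have "integral {0..1} (\<lambda>t. rep_L1 f (circ t) * v t) = integral {0..1} (\<lambda>t. ?s (circ t) * v t)"
    by (rule integral_spike[OF neg]) auto
  then show ?thesis
    using infsumI[OF fourier_sum_integral(2)[OF f v]] by simp
qed

section \<open>Change of variables along the circle map\<close>

lemma absolutely_integrable_shift:
  fixes f :: "real \<Rightarrow> complex"
  shows "(\<lambda>t. f (t + c)) absolutely_integrable_on {a..b} \<and> integral {a..b} (\<lambda>t. f (t + c)) = I
    \<longleftrightarrow> f absolutely_integrable_on {a + c..b + c} \<and> integral {a + c..b + c} f = I"
proof -
  have "((\<lambda>t. t + c) has_field_derivative 1) (at x within {a..b})" for x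
    by (auto intro!: derivative_eq_intros)
  then show ?thesis
    using has_absolute_integral_change_of_variables_real[of "{a..b}" "\<lambda>t. t + c" "\<lambda>_. 1" f I]
    by simp
qed

lemma periodic_integral:
  fixes f :: "real \<Rightarrow> complex"
  assumes per: "\<And>t. f (t + 1) = f t" and f: "f absolutely_integrable_on {0..1}"
  shows "f absolutely_integrable_on {a..a + 1}" "integral {a..a + 1} f = integral {0..1} f"
proof -
  have per_int: "f (t + of_int n) = f t" for t and n :: int
  proof (induction n rule: int_induct[where k = 0])
    case (step1 n)
    then show ?case using per[of "t + of_int n"] by (simp add: add.assoc)
  next
    case (step2 n)
    then show ?case using per[of "t + of_int (n - 1)"] by (simp add: add.assoc)
  qed simp
  define r where "r = frac a"
  have r: "0 \<le> r" "r \<le> 1" by (auto simp: r_def frac_lt_1 less_imp_le)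
  have a: "a = r + of_int \<lfloor>a\<rfloor>" by (simp add: r_def frac_def)
  have f1: "f absolutely_integrable_on {r..1}" and f2: "f absolutely_integrable_on {0..r}"
    using f r by (auto intro: absolutely_integrable_on_subinterval)
  have f3: "f absolutely_integrable_on {1..r + 1}" "integral {1..r + 1} f = integral {0..r} f"
    using absolutely_integrable_shift[where f = f and c = 1 and a = 0 and b = r and I = "integral {0..r} f"] f2 per by auto
  have "f absolutely_integrable_on {r..1} \<union> {1..r + 1}"
    using f1 f3(1) by (rule absolutely_integrable_Un)
  then have f4: "f absolutely_integrable_on {r..r + 1}"
    using r by (simp add: ivl_disj_un_two_touch)
  have "integral {r..r + 1} f = integral {r..1} f + integral {1..r + 1} f"
    using r set_lebesgue_integral_eq_integral(1)[OF f4] by (simp add: Henstock_Kurzweil_Integration.integral_combine)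
  also have "\<dots> = integral {0..r} f + integral {r..1} f" by (simp add: f3(2))
  also have "\<dots> = integral {0..1} f"
    using r set_lebesgue_integral_eq_integral(1)[OF f] by (simp add: Henstock_Kurzweil_Integration.integral_combine)
  finally have f5: "integral {r..r + 1} f = integral {0..1} f" .
  have "f absolutely_integrable_on {r + of_int \<lfloor>a\<rfloor>..r + 1 + of_int \<lfloor>a\<rfloor>} \<and>
      integral {r + of_int \<lfloor>a\<rfloor>..r + 1 + of_int \<lfloor>a\<rfloor>} f = integral {0..1} f"
    using f4 f5 by (subst absolutely_integrable_shift[symmetric]) (simp add: per_int)
  moreover have "r + 1 + of_int \<lfloor>a\<rfloor> = a + 1" using a by simp
  ultimately show "f absolutely_integrable_on {a..a + 1}" "integral {a..a + 1} f = integral {0..1} f"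
    using a by auto
qed

lemma norm_mu: "cmod \<mu> = 3 * sqrt 2 / 8"
  by (simp add: \<mu>_def norm_mult)

lemma norm_mu_less_1: "cmod \<mu> < 1"
proof -
  have "sqrt 2 < 2" by (rule real_less_lsqrt) auto
  then show ?thesis by (simp add: norm_mu)
qed

definition blaschke_den :: "complex \<Rightarrow> complex" where "blaschke_den z = 1 - cnj \<mu> * z"

lemma Re_blaschke_den_pos: assumes "cmod z \<le> 1" shows "Re (blaschke_den z) > 0"
proof -
  have "Re (cnj \<mu> * z) \<le> cmod (cnj \<mu> * z)" by (rule complex_Re_le_cmod)
  also have "\<dots> \<le> cmod \<mu> * 1" unfolding norm_mult complex_mod_cnj using assms by (intro mult_left_mono) auto
  also have "\<dots> < 1" using norm_mu_less_1 by simp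
  finally show ?thesis by (simp add: blaschke_den_def)
qed

lemma blaschke_den_nonzero: "cmod z \<le> 1 \<Longrightarrow> blaschke_den z \<noteq> 0"
  using Re_blaschke_den_pos[of z] by auto

text \<open>
  A lift of the circle map to the line. On the circle \<open>\<mu> - z = - z * cnj w\<close> with \<open>w = 1 - cnj \<mu> * z\<close>, so
  \<open>T z = - z\<^sup>2 * cnj w / w\<close>, and \<open>w\<close> has positive real part, which makes its logarithm smooth.
\<close>

definition lift :: "real \<Rightarrow> real" where
  "lift t = 1 / 2 + 2 * t - Im (Ln (blaschke_den (circ t))) / pi"

definition lift' :: "real \<Rightarrow> real" where
  "lift' t = 2 * Re (inverse (blaschke_den (circ t)))"

lemma blaschke_circ: "blaschke (circ t) = circ (lift t)"
proof -
  let ?w = "blaschke_den (circ t)"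
  have w: "?w \<noteq> 0" by (rule blaschke_den_nonzero) simp
  have "\<mu> - circ t = - circ t * cnj ?w"
    by (simp add: blaschke_den_def cnj_circ field_simps)
  then have "blaschke (circ t) = - (circ t * circ t) * (cnj ?w / ?w)"
    by (simp add: blaschke_def blaschke_den_def)
  also have "cnj ?w / ?w = exp (cnj (Ln ?w) - Ln ?w)"
    using w exp_cnj[of "Ln ?w"] by (simp add: exp_diff)
  also have "cnj (Ln ?w) - Ln ?w = 2 * pi * \<i> * of_real (- Im (Ln ?w) / pi)"
    by (simp add: complex_eq_iff)
  also have "exp \<dots> = circ (- Im (Ln ?w) / pi)"
    by (simp add: circlepath)
  also have "- (circ t * circ t) = circ (1 / 2) * circ (2 * t)"
    by (simp add: circ_cis cis_pi cis_mult)
  finally show ?thesis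
    by (simp add: lift_def diff_conv_add_uminus circ_add del: add_uminus_conv_diff)
qed

lemma lift'_pos: "lift' t > 0"
proof -
  let ?w = "blaschke_den (circ t)"
  have "Re ?w > 0" by (rule Re_blaschke_den_pos) simp
  moreover from this have "(Re ?w)\<^sup>2 + (Im ?w)\<^sup>2 > 0" by (simp add: add_pos_nonneg)
  ultimately show ?thesis by (simp add: lift'_def)
qed

lemma circ_has_vector_derivative:
  "(circ has_vector_derivative 2 * pi * \<i> * circ t) (at t)"
  using has_vector_derivative_circlepath[of 0 1 t UNIV] by (simp add: circlepath mult_ac)

lemma lift_has_derivative: "(lift has_field_derivative lift' t) (at t)"
proof -
  let ?w = "blaschke_den (circ t)"
  have Re: "Re ?w > 0" by (rule Re_blaschke_den_pos) simp
  have nonpos: "?w \<notin> \<real>\<^sub>\<le>\<^sub>0" and w: "?w \<noteq> 0" using Re by (auto simp: complex_nonpos_Reals_iff)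
  have "(blaschke_den has_field_derivative - cnj \<mu>) (at (circ t))"
    unfolding blaschke_den_def by (auto intro!: derivative_eq_intros)
  then have "((\<lambda>z. Ln (blaschke_den z)) has_field_derivative inverse ?w * (- cnj \<mu>)) (at (circ t))"
    by (rule DERIV_chain2[where f = Ln and g = blaschke_den and x = "circ t" and s = UNIV, OF has_field_derivative_Ln[OF nonpos]])
  from field_vector_diff_chain_at[OF circ_has_vector_derivative this]
  have "((\<lambda>t. Ln (blaschke_den (circ t))) has_vector_derivative 2 * pi * \<i> * circ t * (inverse ?w * (- cnj \<mu>))) (at t)"
    by (simp add: o_def)
  from bounded_linear.has_vector_derivative[OF bounded_linear_Im this]
  have "((\<lambda>t. Im (Ln (blaschke_den (circ t)))) has_field_derivative Im (2 * pi * \<i> * circ t * (inverse ?w * (- cnj \<mu>)))) (at t)"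
    by (simp add: has_real_derivative_iff_has_vector_derivative)
  moreover have "Im (2 * pi * \<i> * circ t * (inverse ?w * (- cnj \<mu>))) = 2 * pi - 2 * pi * Re (inverse ?w)"
  proof -
    have "2 * pi * \<i> * circ t * (inverse ?w * (- cnj \<mu>)) = 2 * pi * \<i> * ((?w - 1) * inverse ?w)"
      by (simp add: blaschke_den_def algebra_simps)
    also have "(?w - 1) * inverse ?w = 1 - inverse ?w" using w by (simp add: algebra_simps)
    finally have eq: "2 * pi * \<i> * circ t * (inverse ?w * (- cnj \<mu>)) = 2 * pi * \<i> * (1 - inverse ?w)" .
    have "Im (2 * pi * \<i> * (1 - v)) = 2 * pi - 2 * pi * Re v" for v by (simp add: algebra_simps)
    then show ?thesis unfolding eq .
  qed
  ultimately have der: "((\<lambda>t. Im (Ln (blaschke_den (circ t)))) has_field_derivative 2 * pi - 2 * pi * Re (inverse ?w)) (at t)"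
    by simp
  have "((\<lambda>t. 1 / 2 + 2 * t - Im (Ln (blaschke_den (circ t))) / pi) has_field_derivative
      2 - (2 * pi - 2 * pi * Re (inverse ?w)) / pi) (at t)"
    by (rule DERIV_diff[OF _ DERIV_cdivide[OF der]]) (auto intro!: derivative_eq_intros)
  moreover have "2 - (2 * pi - 2 * pi * Re (inverse ?w)) / pi = lift' t"
    by (simp add: lift'_def diff_divide_distrib del: complex_inverse)
  ultimately show ?thesis by (simp add: lift_def[abs_def])
qed

text \<open>
  Differentiate \<open>T (circ t) = circ (lift t)\<close> and compare moduli.
\<close>

lemma norm_deriv_blaschke: "cmod (deriv blaschke (circ t)) = lift' t"
proof -
  have "blaschke field_differentiable at (circ t)"
    unfolding blaschke_def using blaschke_den_nonzero[of "circ t"]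
    by (intro derivative_intros) (auto simp: blaschke_den_def intro!: derivative_intros)
  then have "(blaschke has_field_derivative deriv blaschke (circ t)) (at (circ t))"
    by (simp add: DERIV_deriv_iff_field_differentiable)
  from field_vector_diff_chain_at[OF circ_has_vector_derivative this]
  have 1: "((\<lambda>t. circ (lift t)) has_vector_derivative 2 * pi * \<i> * circ t * deriv blaschke (circ t)) (at t)"
    by (simp add: o_def blaschke_circ)
  have "(lift has_vector_derivative lift' t) (at t)"
    using lift_has_derivative by (simp add: has_real_derivative_iff_has_vector_derivative)
  from vector_diff_chain_at[OF this circ_has_vector_derivative]
  have 2: "((\<lambda>t. circ (lift t)) has_vector_derivative lift' t *\<^sub>R (2 * pi * \<i> * circ (lift t))) (at t)"
    by (simp add: o_def)
  have "2 * pi * \<i> * circ t * deriv blaschke (circ t) = lift' t *\<^sub>R (2 * pi * \<i> * circ (lift t))"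
    by (rule vector_derivative_unique_at[OF 1 2])
  from arg_cong[OF this, of cmod] show ?thesis
    using lift'_pos[of t] by (simp add: norm_mult)
qed

lemma lift_plus_1: "lift (t + 1) = lift t + 2"
  by (simp add: lift_def circlepath_add1)

lemma strict_mono_lift: "strict_mono lift"
  by (rule strict_monoI, rule DERIV_pos_imp_increasing) (auto intro: lift_has_derivative lift'_pos)

lemma surj_lift: "surj lift"
proof -
  have b: "\<bar>Im (Ln (blaschke_den (circ t)))\<bar> \<le> pi" for t
    using Im_Ln_le_pi[of "blaschke_den (circ t)"] mpi_less_Im_Ln[of "blaschke_den (circ t)"]
      blaschke_den_nonzero[of "circ t"] by auto
  have near: "- 1 \<le> Im (Ln (blaschke_den (circ t))) / pi" "Im (Ln (blaschke_den (circ t))) / pi \<le> 1" for t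
    using b[of t] by (simp_all add: abs_le_iff field_simps)
  have "lift ((s - 2) / 2) \<le> s" "s \<le> lift ((s + 2) / 2)" for s
  proof -
    have "1 / 2 + 2 * ((s - 2) / 2) - x \<le> s" if "- 1 \<le> x" for x
      using that by (simp add: diff_divide_distrib)
    from this[OF near(1)] show "lift ((s - 2) / 2) \<le> s" by (simp only: lift_def)
    have "s \<le> 1 / 2 + 2 * ((s + 2) / 2) - x" if "x \<le> 1" for x
      using that by (simp add: add_divide_distrib)
    from this[OF near(2)] show "s \<le> lift ((s + 2) / 2)" by (simp only: lift_def)
  qed
  moreover have "continuous_on S lift" for S
    by (meson DERIV_isCont continuous_at_imp_continuous_on lift_has_derivative)
  ultimately have "\<exists>t. lift t = s" for s
    using IVT'[of lift "(s - 2) / 2" s "(s + 2) / 2"] by auto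
  then show ?thesis by (metis surjI)
qed

definition unlift :: "real \<Rightarrow> real" where "unlift = inv lift"

lemma lift_unlift [simp]: "lift (unlift s) = s"
  by (simp add: unlift_def surj_f_inv_f surj_lift)

lemma unlift_lift [simp]: "unlift (lift t) = t"
  by (simp add: unlift_def strict_mono_imp_inj_on strict_mono_lift)

lemma unlift_eq_iff: "unlift s = t \<longleftrightarrow> s = lift t"
  by auto

lemma unlift_less_iff: "unlift r < unlift s \<longleftrightarrow> r < s"
  using strict_mono_less[OF strict_mono_lift, of "unlift r" "unlift s"] by simp

lemma lift_plus_int: "lift (t + of_int n) = lift t + 2 * of_int n"
proof (induction n rule: int_induct[where k = 0])
  case (step1 n)
  then show ?case using lift_plus_1[of "t + of_int n"] by (simp add: add.assoc)
next
  case (step2 n)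
  then show ?case using lift_plus_1[of "t + of_int (n - 1)"] by (simp add: add.assoc)
qed simp

lemma unlift_plus_2: "unlift (s + 2) = unlift s + 1"
  by (simp add: unlift_eq_iff lift_plus_1)

text \<open>
  The preimages of \<open>circ s\<close> are the angles that the lift sends to \<open>s + n\<close> for an integer \<open>n\<close>. Since the lift
  increases by \<open>2\<close> over a period, only the parity of \<open>n\<close> matters.
\<close>

lemma blaschke_preimages:
  "{y \<in> sphere 0 1. blaschke y = circ s} = {circ (unlift s), circ (unlift (s + 1))}"
proof (intro equalityI subsetI)
  fix y assume "y \<in> {y \<in> sphere 0 1. blaschke y = circ s}"
  then have y: "y \<in> sphere 0 1" "blaschke y = circ s" by simp_all
  obtain t where t: "y = circ t" using sphere_circE[OF y(1)] by blast
  with y(2) have "circ (lift t) = circ s" by (simp add: blaschke_circ)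
  then obtain n :: int where n: "lift t = s + of_int n" by (auto simp: circ_eq_iff)
  define m where "m = n div 2"
  have "circ t = circ (t - of_int m)" by (subst circ_eq_iff) (auto intro: exI[of _ m])
  have "lift (t - of_int m) = lift t - 2 * of_int m"
    using lift_plus_int[of t "- m"] by simp
  also have "\<dots> = s + of_int (n mod 2)"
    unfolding n m_def by (simp add: minus_div_mult_eq_mod[symmetric] algebra_simps)
  finally have "t - of_int m = unlift (s + of_int (n mod 2))" by (metis unlift_lift)
  moreover have "n mod 2 = 0 \<or> n mod 2 = 1" by presburger
  ultimately show "y \<in> {circ (unlift s), circ (unlift (s + 1))}"
    using t \<open>circ t = circ (t - of_int m)\<close> by auto
qed (use circ_add[of s 1] circ_of_int[of 1] in \<open>auto simp: blaschke_circ\<close>)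

lemma transfer_fun_circ:
  "transfer_fun blaschke \<phi> (circ s) =
    \<phi> (circ (unlift s)) / lift' (unlift s) + \<phi> (circ (unlift (s + 1))) / lift' (unlift (s + 1))"
proof -
  have "circ (unlift s) \<noteq> circ (unlift (s + 1))"
  proof
    assume "circ (unlift s) = circ (unlift (s + 1))"
    then obtain n :: int where n: "unlift (s + 1) = unlift s + of_int n"
      by (metis circ_eq_iff)
    have "unlift s < unlift (s + 1)" "unlift (s + 1) < unlift (s + 2)"
      by (simp_all add: unlift_less_iff)
    then have "0 < n" "n < 1" unfolding unlift_plus_2 n by simp_all
    then show False by simp
  qed
  then show ?thesis
    unfolding transfer_fun_def blaschke_preimages by (simp add: norm_deriv_blaschke)
qed

lemma lift_image: "lift ` {a..b} = {lift a..lift b}"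
proof (intro equalityI subsetI)
  fix s assume "s \<in> {lift a..lift b}"
  then have "unlift s \<in> {a..b}"
    using strict_mono_less_eq[OF strict_mono_lift, of a "unlift s"]
      strict_mono_less_eq[OF strict_mono_lift, of "unlift s" b] by simp
  then show "s \<in> lift ` {a..b}" by (metis image_eqI lift_unlift)
qed (auto simp: strict_mono_less_eq[OF strict_mono_lift])

text \<open>
  The two inverse branches over \<open>{0..1}\<close> together form one function on \<open>{0..2}\<close>, which the lift pulls
  back to an interval of length one.
\<close>

lemma transfer_change_of_variables:
  assumes \<phi>: "integrable_circle \<phi>"
  shows "(\<lambda>s. transfer_fun blaschke \<phi> (circ s) * circ s powi m) absolutely_integrable_on {0..1}"
    and "integral {0..1} (\<lambda>s. transfer_fun blaschke \<phi> (circ s) * circ s powi m)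
      = integral {0..1} (\<lambda>t. \<phi> (circ t) * blaschke (circ t) powi m)"
proof -
  define H where "H t = \<phi> (circ t) * blaschke (circ t) powi m" for t
  define F where "F s = \<phi> (circ (unlift s)) / lift' (unlift s) * circ s powi m" for s
  define a where "a = unlift 0"
  have lift_cont: "continuous_on S lift" for S
    by (meson DERIV_isCont continuous_at_imp_continuous_on lift_has_derivative)
  have "H absolutely_integrable_on {0..1}"
    using \<phi> unfolding H_def integrable_circle_def
    by (intro absolutely_integrable_times_continuous)
       (auto simp: blaschke_circ intro!: continuous_intros lift_cont)
  moreover have "H (t + 1) = H t" for t by (simp add: H_def circlepath_add1)
  ultimately have H: "H absolutely_integrable_on {a..a + 1}" "integral {a..a + 1} H = integral {0..1} H"
    by (auto intro: periodic_integral)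
  have "lift ` {a..a + 1} = {0..2}" by (simp add: lift_image lift_plus_1 a_def)
  moreover have "\<bar>lift' t\<bar> *\<^sub>R F (lift t) = H t" for t
    using lift'_pos[of t] by (simp add: F_def H_def blaschke_circ scaleR_conv_of_real)
  ultimately have F02: "F absolutely_integrable_on {0..2} \<and> integral {0..2} F = integral {0..1} H"
    using has_absolute_integral_change_of_variables_real[of "{a..a + 1}" lift lift' F "integral {0..1} H"] H
    by (auto intro!: DERIV_subset[OF lift_has_derivative] strict_mono_imp_inj_on[OF strict_mono_lift])
  then have F: "F absolutely_integrable_on {0..1}" "F absolutely_integrable_on {1..2}"
    by (auto intro: absolutely_integrable_on_subinterval)
  have F': "(\<lambda>s. F (s + 1)) absolutely_integrable_on {0..1}"
    "integral {0..1} (\<lambda>s. F (s + 1)) = integral {1..2} F"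
    using absolutely_integrable_shift[where f = F and c = 1 and a = 0 and b = 1 and I = "integral {1..2} F"] F(2) by auto
  have split: "transfer_fun blaschke \<phi> (circ s) * circ s powi m = F s + F (s + 1)" for s
    by (simp add: transfer_fun_circ F_def circlepath_add1 distrib_right)
  show "(\<lambda>s. transfer_fun blaschke \<phi> (circ s) * circ s powi m) absolutely_integrable_on {0..1}"
    unfolding split using F(1) F'(1) by (rule set_integral_add(1))
  have "integral {0..1} (\<lambda>s. F s + F (s + 1)) = integral {0..1} F + integral {1..2} F"
    using F F' by (simp add: integral_add set_lebesgue_integral_eq_integral(1))
  also have "\<dots> = integral {0..2} F"
    using F02 set_lebesgue_integral_eq_integral(1)[of "{0..2}" F]
    by (simp add: Henstock_Kurzweil_Integration.integral_combine)
  finally show "integral {0..1} (\<lambda>s. transfer_fun blaschke \<phi> (circ s) * circ s powi m)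
      = integral {0..1} (\<lambda>t. \<phi> (circ t) * blaschke (circ t) powi m)"
    unfolding split using F02 by (simp add: H_def[abs_def])
qed

lemma fourier_coeff_transfer_op:
  "fourier_coeff (transfer_op blaschke f) k
    = integral {0..1} (\<lambda>t. rep_L1 f (circ t) * blaschke (circ t) powi - k)"
proof -
  have "integrable_circle (transfer_fun blaschke (rep_L1 f))"
    using transfer_change_of_variables(1)[OF integrable_circle_rep, of f 0]
    by (simp add: integrable_circle_def)
  then show ?thesis
    by (simp add: transfer_op_def fourier_coeff_abs
        transfer_change_of_variables(2)[OF integrable_circle_rep])
qed

section \<open>The matrix of the transfer operator\<close>

lemma mean_value_circle:
  assumes "continuous_on (cball 0 1) g" "g holomorphic_on ball 0 1"
  shows "integral {0..1} (\<lambda>t. g (circ t)) = g 0"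
proof -
  have "contour_integral circ (\<lambda>z. g z / (z - 0)) = 2 * of_real pi * \<i> * g 0"
    using assms by (intro contour_integral_unique Cauchy_integral_circlepath) auto
  moreover have "contour_integral circ (\<lambda>z. g z / (z - 0)) = 2 * of_real pi * \<i> * integral {0..1} (\<lambda>t. g (circ t))"
  proof -
    have "g (circ t) / (circ t - 0) * vector_derivative circ (at t) = 2 * of_real pi * \<i> * g (circ t)" for t
      using vector_derivative_at[OF circ_has_vector_derivative, of t] by simp
    then show ?thesis unfolding contour_integral_integral by simp
  qed
  ultimately show ?thesis by simp
qed

lemma blaschke_factor_holomorphic:
  "(\<lambda>z. (\<mu> - z) / blaschke_den z) holomorphic_on ball 0 1"
  "continuous_on (cball 0 1) (\<lambda>z. (\<mu> - z) / blaschke_den z)"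
proof -
  have den: "blaschke_den holomorphic_on S" for S unfolding blaschke_den_def by (intro holomorphic_intros)
  show "(\<lambda>z. (\<mu> - z) / blaschke_den z) holomorphic_on ball 0 1"
    using den blaschke_den_nonzero by (intro holomorphic_intros) auto
  show "continuous_on (cball 0 1) (\<lambda>z. (\<mu> - z) / blaschke_den z)"
    using holomorphic_on_imp_continuous_on[OF den] blaschke_den_nonzero
    by (intro continuous_intros) auto
qed

lemma blaschke_eq: "blaschke z = z * ((\<mu> - z) / blaschke_den z)"
  by (simp add: blaschke_def blaschke_den_def)

lemma blaschke_holomorphic: "blaschke holomorphic_on ball 0 1" "continuous_on (cball 0 1) blaschke"
  unfolding blaschke_eq[abs_def]
  by (rule holomorphic_on_mult[OF holomorphic_on_ident blaschke_factor_holomorphic(1)])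
     (rule continuous_on_mult[OF continuous_on_id blaschke_factor_holomorphic(2)])

lemma norm_blaschke_less_1:
  assumes "cmod z < 1"
  shows "cmod (blaschke z) < 1"
proof -
  have "cmod ((\<mu> - z) / blaschke_den z) = cmod (Moebius_function 0 \<mu> z)"
    by (simp add: Moebius_function_def blaschke_den_def norm_divide norm_mult norm_minus_commute)
  also have "\<dots> < 1" using norm_mu_less_1 assms by (rule Moebius_function_norm_lt_1)
  finally have "cmod z * cmod ((\<mu> - z) / blaschke_den z) \<le> cmod z * 1"
    by (intro mult_left_mono) auto
  then show ?thesis using assms unfolding blaschke_eq norm_mult by linarith
qed

definition transfer_matrix :: "int \<Rightarrow> int \<Rightarrow> complex" where
  "transfer_matrix k j = integral {0..1} (\<lambda>t. circ t powi j * blaschke (circ t) powi - k)"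

text \<open>
  \<open>T\<close> has modulus \<open>1\<close> on the circle, so conjugation inverts both \<open>z\<close> and \<open>T z\<close>.
\<close>

lemma transfer_matrix_reflect: "transfer_matrix (- k) (- j) = cnj (transfer_matrix k j)"
  unfolding transfer_matrix_def Henstock_Kurzweil_Integration.integral_cnj
  by (simp add: blaschke_circ cnj_circ power_int_minus flip: power_int_inverse)

text \<open>
  The integrand is the boundary value of the holomorphic function \<open>z\<^sup>n * B\<^sup>m\<close> with \<open>n = m + j\<close>, and its mean
  is the value at \<open>0\<close>.
\<close>

lemma transfer_matrix_diag_below:
  assumes "int m + j \<ge> 0"
  shows "transfer_matrix (- int m) j = (if j = - int m then \<mu> ^ m else 0)"
proof -
  define n where "n = nat (int m + j)"
  let ?g = "\<lambda>z. z ^ n * ((\<mu> - z) / blaschke_den z) ^ m"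
  have "circ t powi j * blaschke (circ t) powi int m = ?g (circ t)" for t
  proof -
    have "circ t powi j * circ t powi int m = circ t powi (j + int m)"
      by (rule power_int_add[symmetric]) simp
    also have "j + int m = int n" using assms by (simp add: n_def)
    finally have "circ t powi j * circ t powi int m = circ t ^ n" by simp
    then show ?thesis
      by (simp only: blaschke_eq power_int_of_nat power_mult_distrib mult.assoc[symmetric])
  qed
  then have "transfer_matrix (- int m) j = integral {0..1} (\<lambda>t. ?g (circ t))"
    by (simp add: transfer_matrix_def)
  also have "\<dots> = ?g 0"
    by (intro mean_value_circle continuous_on_mult continuous_on_power continuous_on_id
        holomorphic_on_mult holomorphic_on_power holomorphic_on_ident blaschke_factor_holomorphic)
  also have "\<dots> = (if j = - int m then \<mu> ^ m else 0)"
    using assms by (auto simp: n_def blaschke_den_def)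
  finally show ?thesis .
qed

text \<open>
  The entry is the Taylor coefficient of order \<open>n\<close> of \<open>T\<^sup>m\<close> at \<open>0\<close>.
\<close>

lemma transfer_matrix_cauchy_bound:
  assumes r: "0 < r" "r < 1" and q: "\<And>z. cmod z = r \<Longrightarrow> cmod (blaschke z) \<le> q"
  shows "cmod (transfer_matrix (- int m) (- int n)) \<le> q ^ m / r ^ n"
proof -
  let ?f = "\<lambda>z. blaschke z ^ m"
  have hol: "?f holomorphic_on ball 0 1" "continuous_on (cball 0 1) ?f"
    using blaschke_holomorphic by (intro holomorphic_intros continuous_intros; simp)+
  have "(deriv ^^ n) ?f 0 = fact n / (2 * pi * \<i>) * contour_integral circ (\<lambda>u. ?f u / (u - 0) ^ Suc n)"
    by (rule Cauchy_higher_derivative_integral_circlepath[OF hol(2,1)]) simp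
  also have "contour_integral circ (\<lambda>u. ?f u / (u - 0) ^ Suc n)
      = 2 * of_real pi * \<i> * transfer_matrix (- int m) (- int n)"
  proof -
    have "?f (circ t) / (circ t - 0) ^ Suc n * vector_derivative circ (at t)
        = 2 * of_real pi * \<i> * (circ t powi - int n * blaschke (circ t) powi - (- int m))" for t
      using vector_derivative_at[OF circ_has_vector_derivative, of t]
      by (simp add: power_int_minus field_simps)
    then show ?thesis unfolding contour_integral_integral transfer_matrix_def by simp
  qed
  finally have "transfer_matrix (- int m) (- int n) = (deriv ^^ n) ?f 0 / fact n"
    by (simp add: field_simps)
  moreover have "cmod ((deriv ^^ n) ?f 0) \<le> fact n * q ^ m / r ^ n"
  proof (rule Cauchy_inequality)
    show "?f holomorphic_on ball 0 r" using r by (intro holomorphic_on_subset[OF hol(1)]) auto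
    show "continuous_on (cball 0 r) ?f" using r by (intro continuous_on_subset[OF hol(2)]) auto
    show "cmod (?f z) \<le> q ^ m" if "cmod (0 - z) = r" for z
      unfolding norm_power using q that by (intro power_mono) auto
  qed (use r in auto)
  then have "cmod ((deriv ^^ n) ?f 0) / fact n \<le> fact n * q ^ m / r ^ n / fact n"
    by (rule divide_right_mono) simp
  ultimately show ?thesis by (simp add: norm_divide)
qed

lemma nonpositive_row_wlog:
  assumes "\<And>m j. P (- int m) j" "\<And>k j. P (- k) (- j) \<Longrightarrow> P k j"
  shows "P k j"
proof (cases "k \<le> 0")
  case True
  then show ?thesis using assms(1)[of "nat (- k)" j] by simp
next
  case False
  then show ?thesis using assms(2)[of k j] assms(1)[of "nat k" "- j"] by simp
qed

lemma transfer_matrix_triangular: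
  "transfer_matrix k j \<noteq> 0 \<Longrightarrow> k = j \<or> nat \<bar>k\<bar> < nat \<bar>j\<bar>"
proof (induction k j rule: nonpositive_row_wlog)
  case (1 m j)
  then show ?case using transfer_matrix_diag_below[of m j] by (cases "int m + j \<ge> 0") (auto split: if_splits)
next
  case (2 k j)
  then show ?case by (simp add: transfer_matrix_reflect)
qed

lemma transfer_matrix_bound:
  assumes r: "0 < r" "r < 1" and q: "\<And>z. cmod z = r \<Longrightarrow> cmod (blaschke z) \<le> q"
  shows "cmod (transfer_matrix k j) \<le> q ^ nat \<bar>k\<bar> / r ^ nat \<bar>j\<bar>"
proof (induction k j rule: nonpositive_row_wlog)
  case (1 m j)
  have "q \<ge> 0" using q[of "of_real r"] r by (intro order_trans[OF norm_ge_zero]) auto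
  show ?case
  proof (cases "j \<le> 0")
    case True
    then show ?thesis using transfer_matrix_cauchy_bound[OF assms, of m "nat (- j)"] by simp
  next
    case False
    then show ?thesis using transfer_matrix_diag_below[of m j] \<open>q \<ge> 0\<close> r by auto
  qed
qed (simp add: transfer_matrix_reflect)

lemma transfer_matrix_diag:
  "transfer_matrix (- int m) (- int m) = \<mu> ^ m"
  "transfer_matrix (int m) (int m) = cnj \<mu> ^ m"
  using transfer_matrix_diag_below[of m "- int m"] transfer_matrix_reflect[of "- int m" "- int m"]
  by simp_all

lemma transfer_matrix_first_columns:
  assumes "\<bar>j\<bar> \<le> 1" "k \<noteq> j"
  shows "transfer_matrix k j = 0"
proof (rule ccontr)
  assume nz: "transfer_matrix k j \<noteq> 0"
  then have "nat \<bar>k\<bar> < nat \<bar>j\<bar>" using transfer_matrix_triangular[OF nz] assms(2) by simp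
  then have "k = 0" "j \<noteq> 0" using assms(1) by auto
  then show False using nz by (simp add: transfer_matrix_def integral_circ_powi)
qed

lemma fourier_coeff_transfer_matrix:
  assumes "(\<lambda>k. cmod (fourier_coeff f k)) summable_on UNIV"
  shows "fourier_coeff (transfer_op blaschke f) k = mat_vec transfer_matrix (fourier_coeff f) k"
proof -
  have "continuous_on {0..1} (\<lambda>t. blaschke (circ t))"
    by (rule continuous_on_compose2[OF blaschke_holomorphic(2)]) (auto intro: continuous_intros)
  then have "continuous_on {0..1} (\<lambda>t. blaschke (circ t) powi - k)"
    by (rule continuous_on_power_int) (simp add: blaschke_circ)
  from fourier_pairing[OF assms this] show ?thesis
    unfolding fourier_coeff_transfer_op mat_vec_def transfer_matrix_def by (simp add: mult.commute)
qed

lemma inner_circle_in_frontier: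
  assumes "1 < R" "cmod z = inverse R"
  shows "z \<in> frontier (annulus R)"
proof -
  have "open (annulus R)"
    unfolding annulus_def by (intro open_Collect_conj open_Collect_less continuous_intros)
  then have "frontier (annulus R) = closure (annulus R) - annulus R"
    by (simp add: frontier_def interior_open)
  moreover have "z \<notin> annulus R" using assms by (simp add: annulus_def)
  moreover have "z \<in> closure (annulus R)"
    unfolding closure_approachable
  proof (intro allI impI)
    fix e :: real assume e: "e > 0"
    have R: "R * R > 1" using assms(1) less_1_mult by blast
    define d where "d = min (e / 2) ((R * R - 1) / 2)"
    have d: "0 < d" "d < e" "d < R * R - 1" using e R by (auto simp: d_def min_def)
    have "cmod ((1 + of_real d) * z) = (1 + d) * inverse R"
      using d(1) assms(2) norm_of_real[of "1 + d", where ?'a = complex] by (simp add: norm_mult)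
    moreover have "(1 + d) * inverse R < R" using d assms(1) by (simp add: field_simps)
    moreover have "inverse R < (1 + d) * inverse R" using d assms(1) by (simp add: field_simps)
    ultimately have "(1 + of_real d) * z \<in> annulus R" by (simp add: annulus_def)
    moreover have "dist ((1 + of_real d) * z) z < e"
    proof -
      have "dist ((1 + of_real d) * z) z = cmod (of_real d * z)" by (simp add: dist_norm algebra_simps)
      also have "\<dots> = d * inverse R" using d(1) assms(2) by (simp add: norm_mult)
      also have "\<dots> \<le> d" using d(1) assms(1) by (intro mult_left_le) (auto simp: inverse_le_1_iff)
      finally show ?thesis using d(2) by simp
    qed
    ultimately show "\<exists>y\<in>annulus R. dist y z < e" by blast
  qed
  ultimately show ?thesis by simp
qed

text \<open>
  The extension \<open>g\<close> of the definition agrees with \<open>T\<close> on the circle of radius \<open>exp (- 2 * pi * \<eta>)\<close> by the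
  identity theorem. There \<open>T\<close> avoids the annulus and has modulus less than \<open>1\<close>, so its values lie on the inner
  boundary circle of the annulus or inside it.
\<close>

lemma admissible_contraction:
  assumes adm: "admissible blaschke \<eta> \<rho>" and z: "cmod z = exp (- (2 * pi * \<eta>))"
  shows "cmod (blaschke z) \<le> exp (- (2 * pi * \<rho>))"
proof -
  define R where "R = exp (2 * pi * \<eta>)"
  obtain \<epsilon> g where \<epsilon>: "\<epsilon> > 0" and \<eta>: "0 < \<eta>" "\<eta> < \<rho>" and g: "g holomorphic_on annulus (R + \<epsilon>)"
    "\<And>z. z \<in> sphere 0 1 \<Longrightarrow> g z = blaschke z"
    "annulus (exp (2 * pi * \<rho>)) \<inter> g ` frontier (annulus R) = {}"
    using adm unfolding admissible_def R_def by blast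
  have R: "1 < R" using \<eta>(1) by (simp add: R_def)
  have zR: "cmod z = inverse R" using z by (simp add: R_def exp_minus)
  let ?A = "annulus (R + \<epsilon>)"
  have A_open: "open ?A"
    unfolding annulus_def by (intro open_Collect_conj open_Collect_less continuous_intros)
  have A_conn: "connected ?A"
    using connected_annulus(1)[where a = "0 :: complex" and ?r1.0 = "inverse (R + \<epsilon>)" and ?r2.0 = "R + \<epsilon>"] by (simp add: annulus_def)
  have inv: "inverse (R + \<epsilon>) < inverse R" "inverse R < 1"
    using R \<epsilon> by (auto simp: field_simps)
  have sphere: "sphere 0 1 \<subseteq> ?A" using R \<epsilon> less_trans[OF inv] by (auto simp: annulus_def)
  have zA: "z \<in> ?A" using zR R \<epsilon> inv by (simp add: annulus_def)
  \<comment> \<open>Without the denominator both sides are holomorphic on the whole annulus, wherever the pole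
    of \<open>T\<close> lies.\<close>
  define d where "d w = blaschke_den w * g w - w * (\<mu> - w)" for w
  have "d z = 0"
  proof (rule analytic_continuation[where f = d and S = ?A and U = "sphere 0 1" and \<xi> = 1])
    show "d holomorphic_on ?A"
      unfolding d_def blaschke_den_def by (intro holomorphic_intros g(1))
    show "(1::complex) islimpt sphere 0 1"
    proof (rule connected_imp_perfect)
      show "sphere 0 1 \<noteq> {x}" for x :: complex
      proof
        assume "sphere 0 1 = {x}"
        moreover have "(- 1 :: complex) \<in> sphere 0 1" "(1 :: complex) \<in> sphere 0 1"
          by simp_all
        ultimately have "(1 :: complex) = - 1" by (metis singletonD)
        then show False by simp
      qed
    qed (auto intro: connected_sphere)
    show "d w = 0" if "w \<in> sphere 0 1" for w
      using g(2)[OF that] blaschke_den_nonzero[of w] that by (simp add: d_def blaschke_eq)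
  qed (use A_open A_conn sphere zA in auto)
  then have "g z = blaschke z"
    using blaschke_den_nonzero[of z] zR inv by (simp add: d_def blaschke_eq field_simps)
  moreover have "z \<in> frontier (annulus R)"
    using R zR by (rule inner_circle_in_frontier)
  ultimately have "blaschke z \<notin> annulus (exp (2 * pi * \<rho>))"
    using g(3) by (metis disjoint_iff image_eqI)
  moreover have "cmod (blaschke z) < 1" using norm_blaschke_less_1 zR inv by simp
  moreover have "1 < exp (2 * pi * \<rho>)" using \<eta> by simp
  ultimately show ?thesis by (auto simp: annulus_def exp_minus)
qed

section \<open>Spectrum and multiplicities\<close>

lemma summable_exp_abs_int:
  fixes c :: real
  assumes "c > 0"
  shows "(\<lambda>k::int. exp (- c * of_int \<bar>k\<bar>)) summable_on UNIV"
proof -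
  have nat: "(\<lambda>n. exp (- c * real n)) summable_on UNIV"
  proof (rule norm_summable_imp_summable_on)
    have "summable (\<lambda>n. exp (- c) ^ n)" using assms by (intro summable_geometric) simp
    then show "summable (\<lambda>n. norm (exp (- c * real n)))"
      by (simp add: mult.commute flip: exp_of_nat_mult)
  qed
  have "(\<lambda>k::int. exp (- c * of_int \<bar>k\<bar>)) summable_on range int"
    using nat by (subst summable_on_reindex) (auto simp: o_def)
  moreover have "(\<lambda>k::int. exp (- c * of_int \<bar>k\<bar>)) summable_on range (\<lambda>n. - int n)"
    using nat by (subst summable_on_reindex) (auto simp: o_def inj_on_def)
  moreover have "range int \<union> range (\<lambda>n. - int n) = UNIV"
    by (auto intro: int_cases2)
  ultimately show ?thesis by (metis summable_on_union)
qed

locale admissible_weight =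
  fixes \<eta> \<rho> \<alpha> :: real
  assumes admissible: "admissible blaschke \<eta> \<rho>" and \<alpha>: "\<alpha> \<in> {\<eta>..<\<rho>}"
begin

definition weight :: "int \<Rightarrow> real" where "weight k = exp (2 * pi * real_of_int \<bar>k\<bar> * \<alpha>)"

sublocale triangular_matrix weight "\<lambda>k. exp (- (2 * pi * (\<rho> - \<alpha>)) * of_int \<bar>k\<bar>)" "\<lambda>k. nat \<bar>k\<bar>" transfer_matrix
proof
  show "(\<lambda>k. exp (- (2 * pi * (\<rho> - \<alpha>)) * of_int \<bar>k\<bar>)) summable_on UNIV"
    using \<alpha> by (intro summable_exp_abs_int) simp
  show "weight k * cmod (transfer_matrix k j) \<le> exp (- (2 * pi * (\<rho> - \<alpha>)) * of_int \<bar>k\<bar>) * weight j" for k j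
  proof -
    have \<eta>: "0 < \<eta>" using admissible by (simp add: admissible_def)
    have power: "exp x ^ nat \<bar>i\<bar> = exp (x * of_int \<bar>i\<bar>)" for x :: real and i
      by (simp add: mult.commute flip: exp_of_nat_mult)
    have "cmod (transfer_matrix k j) \<le> exp (- (2 * pi * \<rho>)) ^ nat \<bar>k\<bar> / exp (- (2 * pi * \<eta>)) ^ nat \<bar>j\<bar>"
      using \<eta> by (intro transfer_matrix_bound admissible_contraction[OF admissible]) auto
    also have "\<dots> = exp (- (2 * pi * \<rho>) * of_int \<bar>k\<bar>) * exp (2 * pi * \<eta> * of_int \<bar>j\<bar>)"
      unfolding power by (simp add: exp_minus field_simps)
    also have "\<dots> \<le> exp (- (2 * pi * \<rho>) * of_int \<bar>k\<bar>) * weight j"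
      using \<alpha> by (intro mult_left_mono) (auto simp: weight_def mult_ac intro: mult_right_mono)
    finally have "weight k * cmod (transfer_matrix k j) \<le> weight k * (exp (- (2 * pi * \<rho>) * of_int \<bar>k\<bar>) * weight j)"
      by (rule mult_left_mono) (simp add: weight_def)
    also have "weight k * exp (- (2 * pi * \<rho>) * of_int \<bar>k\<bar>) = exp (- (2 * pi * (\<rho> - \<alpha>)) * of_int \<bar>k\<bar>)"
      by (simp add: weight_def algebra_simps flip: exp_add)
    then have "weight k * (exp (- (2 * pi * \<rho>) * of_int \<bar>k\<bar>) * weight j) = exp (- (2 * pi * (\<rho> - \<alpha>)) * of_int \<bar>k\<bar>) * weight j"
      by (metis mult.assoc)
    finally show ?thesis .
  qed
  show "finite {k :: int. nat \<bar>k\<bar> < n}" for n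
    by (rule finite_subset[of _ "{- int n..int n}"]) auto
qed (auto simp: weight_def dest: transfer_matrix_triangular)

abbreviation L :: "L1_circle \<Rightarrow> L1_circle" where "L \<equiv> transfer_op blaschke"

lemma mem_A_space: "f \<in> A_space \<alpha> \<longleftrightarrow> wl1 (fourier_coeff f)"
  by (simp add: A_space_def wl1_def weight_def)

lemma A_norm_eq: "A_norm \<alpha> f = wnorm (fourier_coeff f)"
  by (simp add: A_norm_def wnorm_def weight_def)

lemma wl1_imp_summable: "wl1 x \<Longrightarrow> (\<lambda>k. cmod (x k)) summable_on UNIV"
  unfolding wl1_def
proof (rule summable_on_comparison_test)
  have "0 < \<alpha>" using \<alpha> admissible by (auto simp: admissible_def)
  then show "cmod (x k) \<le> weight k * cmod (x k)" for k
    using mult_right_mono[of 1 "weight k" "cmod (x k)"] by (simp add: weight_def)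
qed auto

lemma synthesis:
  assumes "wl1 x" obtains f where "f \<in> A_space \<alpha>" "fourier_coeff f = x"
proof
  show "fourier_coeff (abs_L1 (fourier_sum x)) = x"
    by (rule ext) (rule fourier_coeff_fourier_sum(2)[OF wl1_imp_summable[OF assms]])
  with assms show "abs_L1 (fourier_sum x) \<in> A_space \<alpha>" by (simp add: mem_A_space)
qed

lemma coeff_L: "f \<in> A_space \<alpha> \<Longrightarrow> fourier_coeff (L f) k = mat_vec transfer_matrix (fourier_coeff f) k"
  by (intro fourier_coeff_transfer_matrix wl1_imp_summable) (simp add: mem_A_space)

lemma coeff_resolvent:
  "f \<in> A_space \<alpha> \<Longrightarrow> fourier_coeff (scale_L1 \<zeta> f - L f) =
    (\<lambda>k. \<zeta> * fourier_coeff f k - mat_vec transfer_matrix (fourier_coeff f) k)"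
  by (simp add: fun_eq_iff fourier_coeff_diff fourier_coeff_scale coeff_L)

lemma resolvent_in_A_space:
  assumes "f \<in> A_space \<alpha>" shows "scale_L1 \<zeta> f - L f \<in> A_space \<alpha>"
  using wl1_add[OF wl1_scale[of "fourier_coeff f" \<zeta>] wl1_scale[OF wl1_mat_vec[of "fourier_coeff f"], of "-1"]] assms
  by (simp add: mem_A_space coeff_resolvent)

text \<open>
  Transports the matrix results along the identification of \<open>A_space \<alpha>\<close> with weighted sequences.
\<close>

lemma off_diagonal_in_resolvent_set:
  assumes \<zeta>: "\<zeta> \<noteq> 0" "\<And>k. \<zeta> \<noteq> transfer_matrix k k"
  shows "\<zeta> \<in> resolvent_set \<alpha> L"
proof -
  obtain C where C: "\<And>x. wl1 x \<Longrightarrow> wnorm x \<le> C * wnorm (\<lambda>k. \<zeta> * x k - mat_vec transfer_matrix x k)"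
    using resolvent_estimate[OF \<zeta>] by metis
  have "A_norm \<alpha> f \<le> C * A_norm \<alpha> (scale_L1 \<zeta> f - L f)" if "f \<in> A_space \<alpha>" for f
    using C[of "fourier_coeff f"] that by (simp add: A_norm_eq coeff_resolvent mem_A_space)
  moreover have "bij_betw (\<lambda>f. scale_L1 \<zeta> f - L f) (A_space \<alpha>) (A_space \<alpha>)"
    unfolding bij_betw_def
  proof (intro conjI equalityI subsetI)
    show "inj_on (\<lambda>f. scale_L1 \<zeta> f - L f) (A_space \<alpha>)"
    proof (rule inj_onI)
      fix f g assume fg: "f \<in> A_space \<alpha>" "g \<in> A_space \<alpha>" "scale_L1 \<zeta> f - L f = scale_L1 \<zeta> g - L g"
      let ?x = "\<lambda>k. fourier_coeff f k + (- 1) * fourier_coeff g k"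
      have wl: "wl1 (fourier_coeff f)" "wl1 (\<lambda>k. (- 1) * fourier_coeff g k)"
        using fg wl1_scale[of "fourier_coeff g" "- 1"] by (simp_all add: mem_A_space)
      have "?x k = 0" for k
      proof (rule injective[OF \<zeta>])
        show "wl1 ?x" using wl by (rule wl1_add)
        show "\<zeta> * ?x k = mat_vec transfer_matrix ?x k" for k
          using fun_cong[OF arg_cong[OF fg(3), of fourier_coeff], of k] fg(1,2)
          unfolding mat_vec_add[OF wl] mat_vec_scale by (simp add: coeff_resolvent algebra_simps)
      qed
      then show "f = g" by (intro fourier_coeff_inject) (simp add: eq_neg_iff_add_eq_0)
    qed
    fix g assume "g \<in> A_space \<alpha>"
    then obtain x where x: "wl1 x" "\<And>k. \<zeta> * x k - mat_vec transfer_matrix x k = fourier_coeff g k"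
      using surjective[OF \<zeta>] by (metis mem_A_space)
    obtain f where "f \<in> A_space \<alpha>" "fourier_coeff f = x" by (rule synthesis[OF x(1)])
    moreover from this have "scale_L1 \<zeta> f - L f = g"
      by (intro fourier_coeff_inject) (simp add: coeff_resolvent x(2))
    ultimately show "g \<in> (\<lambda>f. scale_L1 \<zeta> f - L f) ` A_space \<alpha>" by blast
  qed (auto intro: resolvent_in_A_space)
  ultimately show ?thesis unfolding resolvent_set_def by blast
qed

lemma eigenvalue_cases:
  assumes "\<zeta> \<in> eigenvalues \<alpha> L" "\<zeta> \<noteq> 0"
  obtains k where "\<zeta> = transfer_matrix k k"
proof (rule ccontr)
  assume "\<not> thesis"
  then have "\<zeta> \<in> resolvent_set \<alpha> L"
    using assms(2) that by (intro off_diagonal_in_resolvent_set) auto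
  then have inj: "inj_on (\<lambda>f. scale_L1 \<zeta> f - L f) (A_space \<alpha>)"
    by (simp add: resolvent_set_def bij_betw_def)
  obtain f where f: "f \<in> A_space \<alpha>" "f \<noteq> 0" "L f = scale_L1 \<zeta> f"
    using assms(1) by (auto simp: eigenvalues_def)
  have zero: "0 \<in> A_space \<alpha>" by (simp add: mem_A_space wl1_finite_support)
  have N0: "scale_L1 \<zeta> 0 - L 0 = 0"
  proof (rule fourier_coeff_inject)
    show "fourier_coeff (scale_L1 \<zeta> 0 - L 0) k = fourier_coeff 0 k" for k
      unfolding coeff_resolvent[OF zero] by (simp add: mat_vec_def)
  qed
  have "f = 0"
  proof (rule inj_onD[OF inj])
    show "scale_L1 \<zeta> f - L f = scale_L1 \<zeta> 0 - L 0" unfolding N0 f(3) by simp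
  qed (use f(1) zero in auto)
  with f(2) show False by simp
qed

text \<open>
  For \<open>\<bar>k0\<bar> \<le> 1\<close> the function \<open>z\<^bsup>k0\<^esup>\<close> is an eigenfunction, because column \<open>k0\<close> of the matrix has no
  entry off the diagonal.
\<close>

lemma simple_eigenvalue_multiplicity:
  assumes k0: "\<bar>k0\<bar> \<le> 1" and ev: "transfer_matrix k0 k0 \<noteq> 0"
    "\<And>k. k \<noteq> k0 \<Longrightarrow> transfer_matrix k k \<noteq> transfer_matrix k0 k0"
  shows "transfer_matrix k0 k0 \<in> eigenvalues \<alpha> L"
    and "alg_multiplicity \<alpha> L (transfer_matrix k0 k0) = 1"
proof -
  let ?ev = "transfer_matrix k0 k0"
  let ?N = "\<lambda>f. scale_L1 ?ev f - L f"
  let ?\<delta> = "\<lambda>k. if k = k0 then 1 else 0 :: complex"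
  have "wl1 ?\<delta>" by (rule wl1_finite_support) simp
  then obtain e where e: "e \<in> A_space \<alpha>" "fourier_coeff e = ?\<delta>"
    by (rule synthesis)
  have e0: "e \<noteq> 0"
  proof
    assume "e = 0"
    then have "?\<delta> k0 = 0" using e(2) fourier_coeff_zero by metis
    then show False by simp
  qed
  have e_mult: "f = scale_L1 (fourier_coeff f k0) e" if "\<And>k. k \<noteq> k0 \<Longrightarrow> fourier_coeff f k = 0" for f
    by (rule fourier_coeff_inject) (use that in \<open>auto simp: fourier_coeff_scale e(2)\<close>)
  have Ne: "?N e = 0"
    by (rule fourier_coeff_inject)
       (use transfer_matrix_first_columns[OF k0] in \<open>auto simp: coeff_resolvent[OF e(1)] e(2) mat_vec_unit\<close>)
  then have Le: "L e = scale_L1 ?ev e" by simp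
  then show "?ev \<in> eigenvalues \<alpha> L" using e(1) e0 by (auto simp: eigenvalues_def)
  \<comment> \<open>By induction on the exponent: \<open>?N f\<close> is a multiple of \<open>e\<close>, so \<open>f\<close> is one too.\<close>
  have nilpotent: "\<forall>k. k \<noteq> k0 \<longrightarrow> fourier_coeff f k = 0" if "f \<in> A_space \<alpha>" "(?N ^^ n) f = 0" for n f
    using that
  proof (induction n arbitrary: f)
    case (Suc n)
    have "\<forall>k. k \<noteq> k0 \<longrightarrow> fourier_coeff (?N f) k = 0"
    proof (rule Suc.IH)
      show "?N f \<in> A_space \<alpha>" using Suc.prems(1) by (rule resolvent_in_A_space)
      show "(?N ^^ n) (?N f) = 0" using Suc.prems(2) by (simp only: funpow_Suc_right o_apply)
    qed
    then have eq: "?ev * fourier_coeff f k = mat_vec transfer_matrix (fourier_coeff f) k" if "k \<noteq> k0" for k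
      using that Suc.prems(1) by (simp add: coeff_resolvent)
    show ?case
      using simple_eigenvalue[OF ev transfer_matrix_first_columns[OF k0] _ eq] Suc.prems(1)
      by (auto simp: mem_A_space)
  qed simp
  have V: "generalized_eigenspace \<alpha> L ?ev = L1.span {e}"
  proof (intro equalityI subsetI)
    fix f assume "f \<in> generalized_eigenspace \<alpha> L ?ev"
    then have "\<forall>k. k \<noteq> k0 \<longrightarrow> fourier_coeff f k = 0"
      using nilpotent by (auto simp: generalized_eigenspace_def)
    then have "f = scale_L1 (fourier_coeff f k0) e" using e_mult by blast
    then show "f \<in> L1.span {e}" by (metis L1.span_base L1.span_scale singletonI)
  next
    fix f assume "f \<in> L1.span {e}"
    then obtain c where c: "f = scale_L1 c e" by (auto simp: L1.span_singleton)
    have coeff: "fourier_coeff f = (\<lambda>k. c * ?\<delta> k)" by (simp add: c fun_eq_iff fourier_coeff_scale e(2))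
    have f: "f \<in> A_space \<alpha>"
      unfolding mem_A_space coeff by (intro wl1_scale \<open>wl1 ?\<delta>\<close>)
    have "?N f = 0"
      by (rule fourier_coeff_inject)
         (use transfer_matrix_first_columns[OF k0] in
           \<open>auto simp: coeff_resolvent[OF f] coeff mat_vec_scale mat_vec_unit simp del: mult_delta_right\<close>)
    then have "(?N ^^ 1) f = 0" by simp
    then show "f \<in> generalized_eigenspace \<alpha> L ?ev"
      using f unfolding generalized_eigenspace_def by blast
  qed
  have "L1.dim (L1.span {e}) = 1"
    using L1.dim_span_eq_card_independent[of "{e}"] e0 by simp
  then show "alg_multiplicity \<alpha> L ?ev = 1"
    unfolding alg_multiplicity_def V Let_def
    by (auto simp: one_enat_def intro: exI[of _ "{e}"])
qed

end

section \<open>Locating the diagonal entries\<close>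

text \<open>
  The double-angle formula gives \<open>(Re \<mu>)\<^sup>2 = 9/64 * (1 + sqrt 2 / 2)\<close> and \<open>(Im \<mu>)\<^sup>2 = 9/64 * (1 - sqrt 2 / 2)\<close>.
\<close>

lemma mu_estimates:
  "\<bar>Re \<mu> - 49 / 100\<bar> < 1 / 1000" "\<bar>Im \<mu> - 203 / 1000\<bar> < 1 / 1000"
proof -
  have mu: "Re \<mu> = 3 * sqrt 2 / 8 * cos (pi / 8)" "Im \<mu> = 3 * sqrt 2 / 8 * sin (pi / 8)"
    using Re_exp[of "\<i> * of_real pi / 8"] Im_exp[of "\<i> * of_real pi / 8"] by (simp_all add: \<mu>_def)
  have "cos (pi / 8) > 0" "sin (pi / 8) > 0"
    by (auto intro!: cos_gt_zero_pi sin_gt_zero pi_gt_zero simp: field_simps)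
  then have pos: "Re \<mu> > 0" "Im \<mu> > 0" by (simp_all add: mu)
  have "cos (pi / 4) = 2 * (cos (pi / 8))\<^sup>2 - 1" "cos (pi / 4) = 1 - 2 * (sin (pi / 8))\<^sup>2"
    using cos_double_cos[of "pi / 8"] cos_double_sin[of "pi / 8"] by simp_all
  then have sq: "(Re \<mu>)\<^sup>2 = 9 / 64 * (1 + sqrt 2 / 2)" "(Im \<mu>)\<^sup>2 = 9 / 64 * (1 - sqrt 2 / 2)"
    by (simp_all add: mu power_mult_distrib power_divide cos_45 field_simps)
  have sqrt2: "1414 / 1000 < sqrt 2" "sqrt 2 < 1415 / 1000"
    by (rule real_less_rsqrt real_less_lsqrt; simp add: power2_eq_square)+
  have "(489 / 1000)\<^sup>2 < (Re \<mu>)\<^sup>2" "(Re \<mu>)\<^sup>2 < (491 / 1000)\<^sup>2"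
    "(202 / 1000)\<^sup>2 < (Im \<mu>)\<^sup>2" "(Im \<mu>)\<^sup>2 < (204 / 1000)\<^sup>2"
    using sqrt2 unfolding sq by (simp_all add: power2_eq_square)
  then have "489 / 1000 < Re \<mu>" "Re \<mu> < 491 / 1000" "202 / 1000 < Im \<mu>" "Im \<mu> < 204 / 1000"
    using pos by (auto dest!: power_less_imp_less_base)
  then show "\<bar>Re \<mu> - 49 / 100\<bar> < 1 / 1000" "\<bar>Im \<mu> - 203 / 1000\<bar> < 1 / 1000"
    unfolding abs_less_iff by - linarith+
qed

lemma F_simps:
  "F 0 = ball 0 (51 / 100)" "F 1 = ball 1 (1 / 10)"
  "F 2 = ball (Complex (4899611118286257 / 10000000000000000) (- (20294853755482672 / 100000000000000000))) (1 / 100)"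
  "F 3 = ball (Complex (4899611118286279 / 10000000000000000) (20294853755482584 / 100000000000000000)) (1 / 100)"
  by (simp_all add: F_def numeral_2_eq_2 numeral_3_eq_3)

lemma mu_in_F: "\<mu> \<in> F 3" "cnj \<mu> \<in> F 2"
proof -
  have "dist c z < 1 / 100" if "\<bar>Re c - Re z\<bar> + \<bar>Im c - Im z\<bar> < 1 / 100" for c z
    using cmod_le[of "c - z"] that by (simp add: dist_norm)
  then show "\<mu> \<in> F 3" "cnj \<mu> \<in> F 2"
    using mu_estimates by (auto simp: F_simps abs_if split: if_splits)
qed

lemma F_disjoint:
  assumes "i \<le> 3" "j \<le> 3" "z \<in> F i" "z \<in> F j"
  shows "i = j"
proof -
  \<comment> \<open>The coordinates separate \<open>F 1\<close>, \<open>F 2\<close> and \<open>F 3\<close> from each other; the modulus separates them from \<open>F 0\<close>.\<close>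
  have box: "\<bar>Re z - Re c\<bar> < r \<and> \<bar>Im z - Im c\<bar> < r \<and> cmod c - r < cmod z" if "z \<in> ball c r" for c r
    using that abs_Re_le_cmod[of "z - c"] abs_Im_le_cmod[of "z - c"] norm_triangle_ineq2[of c z]
    by (simp add: dist_norm norm_minus_commute)
  have centre: "cmod (Complex (4899611118286257 / 10000000000000000) (- (20294853755482672 / 100000000000000000))) > 52 / 100"
    "cmod (Complex (4899611118286279 / 10000000000000000) (20294853755482584 / 100000000000000000)) > 52 / 100"
    unfolding cmod_def by (rule real_less_rsqrt; simp add: power2_eq_square)+
  have F0: "cmod z < 51 / 100" if "z \<in> F 0"
    using that unfolding F_simps by simp
  have F1: "Re z > 9 / 10 \<and> cmod z > 51 / 100" if "z \<in> F 1"
    using box[OF that[unfolded F_simps]] unfolding abs_less_iff one_complex.sel norm_one by linarith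
  have F2: "Re z < 9 / 10 \<and> Im z < 0 \<and> cmod z > 51 / 100" if "z \<in> F 2"
    using box[OF that[unfolded F_simps]] centre unfolding abs_less_iff complex.sel by linarith
  have F3: "Re z < 9 / 10 \<and> Im z > 0 \<and> cmod z > 51 / 100" if "z \<in> F 3"
    using box[OF that[unfolded F_simps]] centre unfolding abs_less_iff complex.sel by linarith
  have index: "i = (if cmod z < 51 / 100 then 0 else if Re z > 9 / 10 then 1 else if Im z < 0 then 2 else 3)"
    if "i \<le> 3" "z \<in> F i" for i
  proof -
    have "i = 0 \<or> i = 1 \<or> i = 2 \<or> i = 3" using that(1) by arith
    then consider "i = 0" | "i = 1" | "i = 2" | "i = 3" by blast
    then show ?thesis
    proof cases
      case 1
      then show ?thesis using F0 that(2) by simp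
    next
      case 2
      then show ?thesis using F1 that(2) by auto
    next
      case 3
      then show ?thesis using F2 that(2) by auto
    next
      case 4
      then show ?thesis using F3 that(2) by auto
    qed
  qed
  show ?thesis using index[OF assms(1,3)] index[OF assms(2,4)] by simp
qed

definition disk_index :: "int \<Rightarrow> nat" where
  "disk_index k = (if k = 0 then 1 else if k = 1 then 2 else if k = - 1 then 3 else 0)"

lemma transfer_matrix_diag_in_disk: "transfer_matrix k k \<in> F (disk_index k)"
proof -
  have small: "cmod (transfer_matrix k k) < 51 / 100" if "2 \<le> \<bar>k\<bar>"
  proof -
    have "cmod (transfer_matrix k k) = cmod \<mu> ^ nat \<bar>k\<bar>"
      using transfer_matrix_diag[of "nat \<bar>k\<bar>"] by (cases "k \<ge> 0") (auto simp: norm_power)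
    also have "\<dots> \<le> cmod \<mu> ^ 2"
      using that norm_mu_less_1 by (intro power_decreasing) auto
    also have "\<dots> < 51 / 100" by (simp add: norm_mu power_divide power_mult_distrib)
    finally show ?thesis .
  qed
  consider "k = 0" | "k = 1" | "k = - 1" | "2 \<le> \<bar>k\<bar>" by linarith
  then show ?thesis
  proof cases
    case 4
    then show ?thesis using small by (auto simp: disk_index_def F_simps)
  qed (use transfer_matrix_diag[of 0] transfer_matrix_diag[of 1] mu_in_F in
        \<open>auto simp: disk_index_def F_simps(2) simp del: One_nat_def\<close>)
qed

theorem theorem4p6:
  fixes \<eta> \<rho> \<alpha> :: real
  assumes "admissible blaschke \<eta> \<rho>"
    and "\<alpha> \<in> {\<eta>..<\<rho>}"
  shows "spectrum \<alpha> (transfer_op blaschke) \<subseteq> (\<Union>j\<in>{0..3}. F j) \<and>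
         (\<forall>j\<in>{1..3}. total_multiplicity \<alpha> (transfer_op blaschke) (F j) = 1)"
proof (intro conjI ballI subsetI)
  interpret admissible_weight \<eta> \<rho> \<alpha> by unfold_locales (use assms in auto)
  have index: "disk_index k \<le> 3" for k by (simp add: disk_index_def)
  have F0: "0 \<in> F 0" by (simp add: F_simps)
  show "\<zeta> \<in> (\<Union>j\<in>{0..3}. F j)" if "\<zeta> \<in> spectrum \<alpha> (transfer_op blaschke)" for \<zeta>
  proof (rule ccontr)
    assume "\<zeta> \<notin> (\<Union>j\<in>{0..3}. F j)"
    then have out: "\<zeta> \<notin> F j" if "j \<le> 3" for j using that by auto
    have "\<zeta> \<noteq> 0" using out[of 0] F0 by auto
    moreover have "\<zeta> \<noteq> transfer_matrix k k" for k
      using out[OF index[of k]] transfer_matrix_diag_in_disk[of k] by auto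
    ultimately have "\<zeta> \<in> resolvent_set \<alpha> L" by (rule off_diagonal_in_resolvent_set)
    then show False using that by (simp add: spectrum_def)
  qed
  fix j :: nat assume j: "j \<in> {1..3}"
  define k0 :: int where "k0 = (if j = 1 then 0 else if j = 2 then 1 else - 1)"
  have k0: "\<bar>k0\<bar> \<le> 1" "disk_index k0 = j" using j by (auto simp: k0_def disk_index_def)
  let ?ev = "transfer_matrix k0 k0"
  have unique: "k = k0" if "disk_index k = j" for k
    using that j by (auto simp: k0_def disk_index_def split: if_splits)
  have ev: "?ev \<in> F j" using transfer_matrix_diag_in_disk[of k0] k0(2) by simp
  have nonzero: "\<zeta> \<noteq> 0" if "\<zeta> \<in> F j" for \<zeta>
    using F_disjoint[of 0 j \<zeta>] that F0 j by auto
  have only: "k = k0" if "transfer_matrix k k \<in> F j" for k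
    using F_disjoint[OF index[of k], of j, OF _ transfer_matrix_diag_in_disk that] j by (auto intro: unique)
  have "transfer_matrix k k \<noteq> ?ev" if "k \<noteq> k0" for k
    using only[of k] ev that by metis
  note eig = simple_eigenvalue_multiplicity[OF k0(1) nonzero[OF ev] this]
  have "F j \<inter> eigenvalues \<alpha> L = {?ev}"
  proof (intro equalityI subsetI)
    fix \<zeta> assume \<zeta>: "\<zeta> \<in> F j \<inter> eigenvalues \<alpha> L"
    then obtain k where "\<zeta> = transfer_matrix k k"
      using eigenvalue_cases[of \<zeta>] nonzero[of \<zeta>] by blast
    with \<zeta> only[of k] show "\<zeta> \<in> {?ev}" by blast
  qed (use ev eig in auto)
  then show "total_multiplicity \<alpha> (transfer_op blaschke) (F j) = 1"
    using eig(2) by (simp add: total_multiplicity_def)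
qed

end
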